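(* Let $m,n\geq 2$ and $c_{\mathrm{small}}\geq 0$ be integers, and let $c_{\mathrm{large}}\geq 2^n c_{\mathrm{small}}$ be an integer. Let $C:\mathbb{N}\times\mathbb{N}\to\mathbb{N}$ be a function such that for all integers $x,y$ and every tournament $T'$ in which every subtournament with clique number at least $y$ contains a copy of $D_{n-1}$, either $\overrightarrow{\omega}(T')<C(x,y)$, or $T'$ contains $D_n$, or $T'$ contains an $(x,y)$-$\overrightarrow{\omega}$-bag-chain of length $8$. Let $T$ be a tournament such that $T$ contains neither $A_m$ nor $D_n$, and every subtournament $T'$ of $T$ with $\overrightarrow{\omega}(T')\geq c_{\mathrm{small}}$ contains a copy of $A_{m-1}$ and a copy of $D_{n-1}$. Then $$\overrightarrow{\omega}(T)\leq 16m\max\{c_{\mathrm{large}},\ C(c_{\mathrm{large}},c_{\mathrm{small}}),\ (4\cdot m!+1)c_{\mathrm{small}}\}.$$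
   Context: A tournament is a finite directed graph with exactly one arc between each pair of distinct vertices; $N^+(v)$, $N^-(v)$ denote out- and in-neighbourhoods. For a total ordering $<$ of $V(T)$, the backedge graph $B(T,<)$ is the graph on $V(T)$ with an edge $uv$ for every pair $u<v$ with $vu \in A(T)$; $\overrightarrow{\omega}(T)=\min_<\omega(B(T,<))$ over all total orderings, and for $X\subseteq V(T)$, $\overrightarrow{\omega}(X)=\overrightarrow{\omega}(T[X])$. A tournament contains (a copy of) $H$ if some induced subtournament is isomorphic to $H$. For disjoint vertex sets $X,Y$, $X\Rightarrow Y$ means $xy$ is an arc for all $x\in X,y\in Y$. The tournament $A_1$ is a single vertex; for $k\ge 2$, $A_k$ consists of vertex-disjoint tournaments $T_1,\dots,T_{k-1}$, each isomorphic to $A_{k-1}$, and further vertices $v_1,\dots,v_k$, with: $A_k[V(T_i)]=T_i$; $v_j\Rightarrow v_i$ whenever $i<j$; $V(T_i)\Rightarrow V(T_j)$ whenever $i<j$; $v_i\Rightarrow V(T_j)$ whenever $i\le j$; and $V(T_j)\Rightarrow v_i$ whenever $i>j$. The tournament $D_1$ is a single vertex, and $D_k$ is obtained from two disjoint copies $T_1,T_2$ of $D_{k-1}$ and one further vertex $w$ with $V(T_1)\Rightarrow V(T_2)$, $V(T_2)\Rightarrow w$, $w \Rightarrow V(T_1)$. For integers $c',a$, a $(c',a)$-$\overrightarrow{\omega}$-bag-chain of length $t$ in a tournament is a tuple $(B_1,\dots,B_t)$ of pairwise disjoint vertex sets with $\overrightarrow{\omega}(B_i)=c'$ for all $i$,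 such that for all $1\le i<j\le t$: $\overrightarrow{\omega}(N^+(v)\cap B_i)<a$ for every $v\in B_j$, and $\overrightarrow{\omega}(N^-(w)\cap B_j)<a$ for every $w\in B_i$. (Such a function $C$ exists; the paper uses a specific one.) *)

theory Defs
  imports "Graph_Theory.Graph_Theory"
begin

text \<open>
  Digraphs, induced subgraphs and isomorphism are those of Graph_Theory. The null graph is a
  tournament, so it also counts as a subtournament (of clique number 0) of every tournament.
\<close>

locale tournament = digraph T for T :: "('a, 'b) pre_digraph" +
  assumes exactly_one_arc:
    "\<lbrakk>u \<in> verts T; v \<in> verts T; u \<noteq> v\<rbrakk> \<Longrightarrow> u \<rightarrow>\<^bsub>T\<^esub> v \<longleftrightarrow> \<not> v \<rightarrow>\<^bsub>T\<^esub> u"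

definition out_nbhd :: "('a, 'b) pre_digraph \<Rightarrow> 'a \<Rightarrow> 'a set" where
  "out_nbhd T v = {u \<in> verts T. v \<rightarrow>\<^bsub>T\<^esub> u}"

definition in_nbhd :: "('a, 'b) pre_digraph \<Rightarrow> 'a \<Rightarrow> 'a set" where
  "in_nbhd T v = {u \<in> verts T. u \<rightarrow>\<^bsub>T\<^esub> v}"

text \<open>Undirected graphs are symmetric digraphs, as usual in Graph_Theory.\<close>

definition clique_number :: "('a, 'b) pre_digraph \<Rightarrow> nat" where
  "clique_number G =
    Max {card K | K. K \<subseteq> verts G \<and> (\<forall>u \<in> K. \<forall>v \<in> K. u \<noteq> v \<longrightarrow> u \<rightarrow>\<^bsub>G\<^esub> v)}"

definition backedge_graph :: "('a, 'b) pre_digraph \<Rightarrow> 'a rel \<Rightarrow> 'a pair_pre_digraph" where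
  "backedge_graph T r =
    \<lparr>pverts = verts T,
     parcs = {(u, v). u \<in> verts T \<and> v \<in> verts T \<and>
       ((u, v) \<in> r \<and> v \<rightarrow>\<^bsub>T\<^esub> u \<or> (v, u) \<in> r \<and> u \<rightarrow>\<^bsub>T\<^esub> v)}\<rparr>"

definition tournament_clique_number :: "('a, 'b) pre_digraph \<Rightarrow> nat" where
  "tournament_clique_number T =
    Min {clique_number (with_proj (backedge_graph T r)) | r. strict_linear_order_on (verts T) r}"

definition contains_copy :: "('a, 'b) pre_digraph \<Rightarrow> ('c, 'd) pre_digraph \<Rightarrow> bool" where
  "contains_copy T H \<longleftrightarrow> (\<exists>S. induced_subgraph S T \<and> digraph_iso S H)"

text \<open>
  Vertices of the tournaments \<open>A\<^sub>k\<close> and \<open>D\<^sub>k\<close>: \<open>Copy j x\<close> is the vertex \<open>x\<close> of the \<open>j\<close>-th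
  copy \<open>T\<^sub>j\<close> of the previous tournament and \<open>Apex i\<close> is the additional vertex \<open>v\<^sub>i\<close>
  (\<open>Apex 1\<close> is \<open>w\<close> in the case of \<open>D\<^sub>k\<close>).
\<close>

datatype vertex = Apex nat | Copy nat vertex

definition A_step :: "nat \<Rightarrow> vertex pair_pre_digraph \<Rightarrow> vertex pair_pre_digraph" where
  "A_step k T =
    \<lparr>pverts = {Apex i | i. 1 \<le> i \<and> i \<le> k} \<union> {Copy j x | j x. 1 \<le> j \<and> j \<le> k - 1 \<and> x \<in> pverts T},
     parcs =
       {(Copy j x, Copy j y) | j x y. 1 \<le> j \<and> j \<le> k - 1 \<and> (x, y) \<in> parcs T} \<union>
       {(Apex j, Apex i) | i j. 1 \<le> i \<and> i < j \<and> j \<le> k} \<union>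
       {(Copy i x, Copy j y) | i j x y.
          1 \<le> i \<and> i < j \<and> j \<le> k - 1 \<and> x \<in> pverts T \<and> y \<in> pverts T} \<union>
       {(Apex i, Copy j x) | i j x. 1 \<le> i \<and> i \<le> j \<and> j \<le> k - 1 \<and> x \<in> pverts T} \<union>
       {(Copy j x, Apex i) | i j x. 1 \<le> j \<and> j < i \<and> i \<le> k \<and> x \<in> pverts T}\<rparr>"

text \<open>The values of \<open>A_pair\<close> and \<open>D_pair\<close> at 0 are arbitrary.\<close>

fun A_pair :: "nat \<Rightarrow> vertex pair_pre_digraph" where
  "A_pair 0 = \<lparr>pverts = {}, parcs = {}\<rparr>"
| "A_pair (Suc 0) = \<lparr>pverts = {Apex 1}, parcs = {}\<rparr>"
| "A_pair (Suc (Suc k)) = A_step (Suc (Suc k)) (A_pair (Suc k))"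

definition D_step :: "vertex pair_pre_digraph \<Rightarrow> vertex pair_pre_digraph" where
  "D_step T =
    \<lparr>pverts = Copy 1 ` pverts T \<union> Copy 2 ` pverts T \<union> {Apex 1},
     parcs =
       {(Copy j x, Copy j y) | j x y. j \<in> {1, 2} \<and> (x, y) \<in> parcs T} \<union>
       (Copy 1 ` pverts T) \<times> (Copy 2 ` pverts T) \<union>
       (Copy 2 ` pverts T) \<times> {Apex 1} \<union>
       {Apex 1} \<times> (Copy 1 ` pverts T)\<rparr>"

fun D_pair :: "nat \<Rightarrow> vertex pair_pre_digraph" where
  "D_pair 0 = \<lparr>pverts = {}, parcs = {}\<rparr>"
| "D_pair (Suc 0) = \<lparr>pverts = {Apex 1}, parcs = {}\<rparr>"
| "D_pair (Suc (Suc k)) = D_step (D_pair (Suc k))"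

abbreviation A_tournament :: "nat \<Rightarrow> (vertex, vertex \<times> vertex) pre_digraph" where
  "A_tournament k \<equiv> with_proj (A_pair k)"

abbreviation D_tournament :: "nat \<Rightarrow> (vertex, vertex \<times> vertex) pre_digraph" where
  "D_tournament k \<equiv> with_proj (D_pair k)"

definition bag_chain :: "('a, 'b) pre_digraph \<Rightarrow> nat \<Rightarrow> nat \<Rightarrow> nat \<Rightarrow> 'a set list \<Rightarrow> bool" where
  "bag_chain T c a t Bs \<longleftrightarrow>
    length Bs = t \<and>
    (\<forall>i < t. Bs ! i \<subseteq> verts T \<and> tournament_clique_number (T \<restriction> (Bs ! i)) = c) \<and>
    (\<forall>i j. i < j \<and> j < t \<longrightarrow>
      Bs ! i \<inter> Bs ! j = {} \<and>
      (\<forall>v \<in> Bs ! j. tournament_clique_number (T \<restriction> (out_nbhd T v \<inter> Bs ! i)) < a) \<and>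
      (\<forall>w \<in> Bs ! i. tournament_clique_number (T \<restriction> (in_nbhd T w \<inter> Bs ! j)) < a))"

text \<open>
  The condition on the function \<open>C\<close>. It ranges over all finite tournaments; as a HOL formula
  cannot quantify over types, they are represented, without loss up to isomorphism, by those
  whose vertices are natural numbers (and whose arcs are pairs of them).
\<close>

definition bag_chain_function :: "nat \<Rightarrow> (nat \<Rightarrow> nat \<Rightarrow> nat) \<Rightarrow> bool" where
  "bag_chain_function n C \<longleftrightarrow>
    (\<forall>x y. \<forall>T' :: (nat, nat \<times> nat) pre_digraph.
      tournament T' \<and>
      (\<forall>S. induced_subgraph S T' \<and> y \<le> tournament_clique_number S \<longrightarrow>
        contains_copy S (D_tournament (n - 1))) \<longrightarrow>
      tournament_clique_number T' < C x y \<or>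
      contains_copy T' (D_tournament n) \<or>
      (\<exists>Bs. bag_chain T' x y 8 Bs))"

end

theory Submission
  imports Defs
begin

text \<open>
  Call a set small if its clique number is below \<open>c_small\<close>. If \<open>x\<close> has a large out-neighbourhood
  inside \<open>X\<close> and a huge in-neighbourhood inside \<open>Y\<close>, where every vertex of \<open>X\<close> has a small
  in-neighbourhood in \<open>Y\<close>, then two copies of \<open>D\<^sub>n\<^sub>-\<^sub>1\<close> and \<open>x\<close> form a \<open>D\<^sub>n\<close>. Hence, in a
  \<open>D\<^sub>n\<close>-free tournament, each vertex has a well-defined position (zone) with respect to a
  bag-chain, up to two exceptional bags, and vertices of zones with a bag between them behave like
  vertices of different bags. In a longest bag-chain every zone has clique number below
  \<open>C(c_large, c_small)\<close>, since the 8 bags found in a zone could otherwise replace 4 old ones.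

  Group consecutive zones into blocks whose clique numbers lie between \<open>M\<close> and \<open>2 M\<close>, where \<open>M\<close> is
  the maximum in the theorem, and order the vertices block by block. If the clique number exceeds
  \<open>16 m M\<close>, a clique of the backedge graph meets \<open>8 m\<close> blocks, so it contains \<open>v\<^sub>1, \<dots>, v\<^sub>m\<close> lying
  8 blocks apart. Copies of \<open>A\<^sub>m\<^sub>-\<^sub>1\<close> chosen greedily in blocks between them complete an \<open>A\<^sub>m\<close>.
\<close>

section \<open>The clique number of a set of vertices\<close>

text \<open>A tournament is represented by an arc relation \<open>E\<close> and a vertex set, so
  that passing to a subtournament is passing to a subset. For a strict linear order \<open>r\<close>
  each pair is tested once, in the direction of \<open>r\<close>; these sets are the cliques of the
  symmetric backedge graph.\<close>

definition backedge_clique :: "'a rel \<Rightarrow> 'a rel \<Rightarrow> 'a set \<Rightarrow> bool" where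
  "backedge_clique E r K \<longleftrightarrow> (\<forall>u\<in>K. \<forall>v\<in>K. (u, v) \<in> r \<longrightarrow> (v, u) \<in> E)"

text \<open>The min-max is described by its upper bounds, which avoids \<open>Min\<close> and
  \<open>Max\<close> over sets of clique sizes. Agreement with the original notion is
  \<open>tournament_clique_number_eq_omega\<close>.\<close>

definition omega_le :: "'a rel \<Rightarrow> 'a set \<Rightarrow> nat \<Rightarrow> bool" where
  "omega_le E X k \<longleftrightarrow>
    (\<exists>r. strict_linear_order_on X r \<and> (\<forall>K\<subseteq>X. backedge_clique E r K \<longrightarrow> card K \<le> k))"

definition omega :: "'a rel \<Rightarrow> 'a set \<Rightarrow> nat" where
  "omega E X = (LEAST k. omega_le E X k)"

lemma ex_strict_linear_order_on:
  assumes "finite X"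
  shows "\<exists>r. strict_linear_order_on X r"
proof -
  obtain f :: "'a \<Rightarrow> nat" where f: "inj_on f X"
    using finite_imp_inj_to_nat_seg[OF assms] by blast
  have "strict_linear_order_on X {(x, y). f x < f y}"
    unfolding strict_linear_order_on_def trans_def irrefl_def total_on_def
    using f by (auto simp: neq_iff[symmetric] inj_on_eq_iff)
  then show ?thesis by blast
qed

lemma strict_linear_order_on_subset:
  "strict_linear_order_on Y r \<Longrightarrow> X \<subseteq> Y \<Longrightarrow> strict_linear_order_on X r"
  unfolding strict_linear_order_on_def total_on_def by blast

lemma omega_le_card: "finite X \<Longrightarrow> omega_le E X (card X)"
  unfolding omega_le_def using ex_strict_linear_order_on[of X] by (auto intro: card_mono)

lemma omega_le_omega: "finite X \<Longrightarrow> omega_le E X (omega E X)"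
  unfolding omega_def using omega_le_card LeastI by metis

lemma omega_leI: "omega_le E X k \<Longrightarrow> omega E X \<le> k"
  unfolding omega_def by (rule Least_le)

lemma omega_le_mono: "omega_le E Y k \<Longrightarrow> X \<subseteq> Y \<Longrightarrow> k \<le> l \<Longrightarrow> omega_le E X l"
  unfolding omega_le_def
  by (elim exE conjE, rule exI, rule conjI, erule (1) strict_linear_order_on_subset)
    (blast intro: order_trans)

lemma omega_mono: "finite Y \<Longrightarrow> X \<subseteq> Y \<Longrightarrow> omega E X \<le> omega E Y"
  by (rule omega_leI, rule omega_le_mono[OF omega_le_omega]) auto

lemma omega_card_le: "finite X \<Longrightarrow> omega E X \<le> card X"
  by (simp add: omega_leI omega_le_card)

lemma omega_empty [simp]: "omega E {} = 0"
  using omega_card_le[of "{}" E] by simp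

text \<open>Order first by \<beta> and, inside each block, by an ordering witnessing
  \<open>M b\<close>. A clique of the whole ordering meets a block in a clique for the ordering of
  that block.\<close>

lemma ex_block_ordering:
  fixes \<beta> :: "'a \<Rightarrow> nat"
  assumes "\<And>b. omega_le E {x \<in> V. \<beta> x = b} (M b)"
  obtains r where "strict_linear_order_on V r" "\<And>u v. \<beta> u < \<beta> v \<Longrightarrow> (u, v) \<in> r"
    "\<And>K b. K \<subseteq> V \<Longrightarrow> backedge_clique E r K \<Longrightarrow> card {x \<in> K. \<beta> x = b} \<le> M b"
proof -
  obtain R where R: "\<And>b. strict_linear_order_on {x \<in> V. \<beta> x = b} (R b)"
    "\<And>b K. K \<subseteq> {x \<in> V. \<beta> x = b} \<Longrightarrow> backedge_clique E (R b) K \<Longrightarrow> card K \<le> M b"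
    using assms unfolding omega_le_def by metis
  define r where "r = {(x, y). \<beta> x < \<beta> y \<or> \<beta> x = \<beta> y \<and> (x, y) \<in> R (\<beta> x)}"
  show thesis
  proof
    show "strict_linear_order_on V r"
      unfolding strict_linear_order_on_def
    proof (intro conjI)
      have "trans (R b)" for b
        using R(1)[of b] unfolding strict_linear_order_on_def by blast
      then show "trans r"
        unfolding r_def by (intro transI) (fastforce dest: transD)
      show "irrefl r"
        using R(1) unfolding strict_linear_order_on_def r_def irrefl_def by auto
      show "total_on V r"
        unfolding total_on_def
      proof (intro ballI impI)
        fix x y assume *: "x \<in> V" "y \<in> V" "x \<noteq> y"
        then show "(x, y) \<in> r \<or> (y, x) \<in> r"
          using R(1)[of "\<beta> x"] unfolding strict_linear_order_on_def total_on_def r_def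
          by (cases "\<beta> x" "\<beta> y" rule: linorder_cases) auto
      qed
    qed
    show "(u, v) \<in> r" if "\<beta> u < \<beta> v" for u v
      using that by (simp add: r_def)
    show "card {x \<in> K. \<beta> x = b} \<le> M b" if "K \<subseteq> V" "backedge_clique E r K" for K b
      using that by (intro R(2)) (auto simp: backedge_clique_def r_def)
  qed
qed

text \<open>Place \<open>X\<close> before \<open>Y - X\<close>: a clique of the resulting ordering
  splits into a clique of each part.\<close>

lemma omega_Un_le:
  assumes "finite X" "finite Y"
  shows "omega E (X \<union> Y) \<le> omega E X + omega E Y"
proof -
  define \<beta> :: "'a \<Rightarrow> nat" where "\<beta> x = (if x \<in> X then 0 else 1)" for x
  define M where "M b = (if b = 0 then omega E X else omega E Y)" for b :: nat
  have "omega_le E {x \<in> X \<union> Y. \<beta> x = b} (M b)" for b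
  proof (cases "b = 0")
    case True
    then show ?thesis
      by (auto simp: \<beta>_def M_def intro!: omega_le_mono[OF omega_le_omega[OF assms(1)]]
          split: if_splits)
  next
    case False
    then show ?thesis
      by (auto simp: \<beta>_def M_def intro!: omega_le_mono[OF omega_le_omega[OF assms(2)]]
          split: if_splits)
  qed
  then obtain r where r: "strict_linear_order_on (X \<union> Y) r"
    "\<And>K b. K \<subseteq> X \<union> Y \<Longrightarrow> backedge_clique E r K \<Longrightarrow> card {x \<in> K. \<beta> x = b} \<le> M b"
    by (rule ex_block_ordering) blast
  have "card K \<le> omega E X + omega E Y" if K: "K \<subseteq> X \<union> Y" "backedge_clique E r K" for K
  proof -
    have "K = {x \<in> K. \<beta> x = 0} \<union> {x \<in> K. \<beta> x = 1}"
      by (auto simp: \<beta>_def)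
    then have "card K \<le> card {x \<in> K. \<beta> x = 0} + card {x \<in> K. \<beta> x = 1}"
      by (metis (lifting) card_Un_le)
    also have "\<dots> \<le> M 0 + M 1"
      using r(2)[OF K] add_mono by blast
    finally show ?thesis by (simp add: M_def)
  qed
  with r(1) show ?thesis
    by (intro omega_leI) (auto simp: omega_le_def)
qed

lemma omega_UN_le:
  assumes "finite W" "\<And>w. w \<in> W \<Longrightarrow> finite (F w)" "\<And>w. w \<in> W \<Longrightarrow> omega E (F w) \<le> k"
  shows "omega E (\<Union>w\<in>W. F w) \<le> card W * k"
  using assms
proof (induction W)
  case (insert w W)
  have "omega E (\<Union>w\<in>insert w W. F w) \<le> omega E (F w) + omega E (\<Union>w\<in>W. F w)"
    using insert.hyps insert.prems omega_Un_le[of "F w" "\<Union>w\<in>W. F w" E] by auto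
  also have "\<dots> \<le> k + card W * k"
    using insert by (intro add_mono) auto
  finally show ?case using insert.hyps by simp
qed simp

text \<open>Subadditivity in the form behind all greedy choices: if \<open>F w\<close> is the
  neighbourhood of \<open>w\<close> on the unwanted side, the remainder of \<open>X\<close> has no
  wrongly directed arc with any \<open>w\<close>, and little has been lost.\<close>

lemma omega_Diff_UN:
  assumes "finite X" "finite W" "\<And>w. w \<in> W \<Longrightarrow> omega E (F w \<inter> X) \<le> k"
  shows "omega E X \<le> omega E (X - (\<Union>w\<in>W. F w)) + card W * k"
proof -
  have "omega E X \<le> omega E ((X - (\<Union>w\<in>W. F w)) \<union> (\<Union>w\<in>W. F w \<inter> X))"
    using assms by (intro omega_mono) auto
  also have "\<dots> \<le> omega E (X - (\<Union>w\<in>W. F w)) + omega E (\<Union>w\<in>W. F w \<inter> X)"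
    using assms by (intro omega_Un_le) auto
  also have "omega E (\<Union>w\<in>W. F w \<inter> X) \<le> card W * k"
    using assms by (intro omega_UN_le) auto
  finally show ?thesis by simp
qed

text \<open>Orderings are transported along an isomorphism. This allows a tournament on any vertex
  type to be replaced by one on natural numbers.\<close>

lemma omega_image:
  assumes inj: "inj_on g X"
    and E: "\<And>u v. u \<in> X \<Longrightarrow> v \<in> X \<Longrightarrow> (g u, g v) \<in> F \<longleftrightarrow> (u, v) \<in> E"
  shows "omega F (g ` X) = omega E X"
proof -
  \<comment> \<open>Stated for an arbitrary injection, since it is applied both to \<open>g\<close>
    and to its inverse.\<close>
  have aux: "omega_le F (h ` Y) k"
    if h: "inj_on h Y" and F: "\<And>u v. u \<in> Y \<Longrightarrow> v \<in> Y \<Longrightarrow> (h u, h v) \<in> F \<longleftrightarrow> (u, v) \<in> E"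
      and le: "omega_le E Y k"
    for h :: "'c \<Rightarrow> 'd" and Y F E k
  proof -
    obtain r where r: "strict_linear_order_on Y r"
      "\<And>K. K \<subseteq> Y \<Longrightarrow> backedge_clique E r K \<Longrightarrow> card K \<le> k"
      using le unfolding omega_le_def by blast
    let ?i = "inv_into Y h"
    have "strict_linear_order_on (h ` Y) (inv_image r ?i)"
      using r(1) h unfolding strict_linear_order_on_def
      by (auto simp: irrefl_def total_on_def inj_on_eq_iff intro: trans_inv_image)
    moreover have "card K \<le> k" if K: "K \<subseteq> h ` Y" "backedge_clique F (inv_image r ?i) K" for K
    proof -
      have "card K = card (?i ` K)"
        using K(1) by (metis card_image inj_on_inv_into)
      also have "\<dots> \<le> k"
      proof (rule r(2))
        show "?i ` K \<subseteq> Y" using K(1) by (auto intro: inv_into_into)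
        show "backedge_clique E r (?i ` K)"
          unfolding backedge_clique_def
        proof clarify
          fix a b assume ab: "a \<in> K" "b \<in> K" "(?i a, ?i b) \<in> r"
          then have "(h (?i b), h (?i a)) \<in> F"
            using K by (auto simp: backedge_clique_def f_inv_into_f subset_iff)
          then show "(?i b, ?i a) \<in> E"
            using F ab K(1) by (meson inv_into_into subsetD)
        qed
      qed
      finally show ?thesis .
    qed
    ultimately show ?thesis unfolding omega_le_def by blast
  qed
  have "omega_le F (g ` X) k \<longleftrightarrow> omega_le E X k" for k
  proof
    assume "omega_le E X k"
    then show "omega_le F (g ` X) k" using aux[OF inj] E by blast
  next
    assume *: "omega_le F (g ` X) k"
    have "omega_le E (inv_into X g ` g ` X) k"
      by (rule aux[OF _ _ *]) (auto simp: inj E inj_on_inv_into)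
    then show "omega_le E X k"
      using inj by (simp add: inv_into_image_cancel)
  qed
  then show ?thesis by (simp add: omega_def)
qed

section \<open>Copies of tournaments\<close>

text \<open>Between tournaments, a homomorphism is automatically an embedding as an induced subtournament.\<close>

definition hom_into :: "'a rel \<Rightarrow> 'a set \<Rightarrow> 'v pair_pre_digraph \<Rightarrow> ('v \<Rightarrow> 'a) \<Rightarrow> bool" where
  "hom_into E X H f \<longleftrightarrow> f ` pverts H \<subseteq> X \<and> (\<forall>(a, b) \<in> parcs H. (f a, f b) \<in> E)"

lemma hom_into_mono: "hom_into E X H f \<Longrightarrow> X \<subseteq> Y \<Longrightarrow> hom_into E Y H f"
  unfolding hom_into_def by blast

definition pair_tournament :: "'v pair_pre_digraph \<Rightarrow> bool" where
  "pair_tournament H \<longleftrightarrow> finite (pverts H) \<and> parcs H \<subseteq> pverts H \<times> pverts H \<and>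
    asym (parcs H) \<and>
    total_on (pverts H) (parcs H)"

section \<open>The tournaments \<open>A_k\<close> and \<open>D_k\<close>: their arcs and their
  orders\<close>

lemma A_step_verts:
  "pverts (A_step k T) = Apex ` {1..k} \<union> (\<lambda>(j, x). Copy j x) ` ({1..k - 1} \<times> pverts T)"
  by (auto simp: A_step_def)

lemma D_step_verts:
  "pverts (D_step T) = Copy 1 ` pverts T \<union> Copy 2 ` pverts T \<union> {Apex 1}"
  by (auto simp: D_step_def)

lemma A_step_simps:
  "Apex i \<in> pverts (A_step k T) \<longleftrightarrow> 1 \<le> i \<and> i \<le> k"
  "Copy j x \<in> pverts (A_step k T) \<longleftrightarrow> 1 \<le> j \<and> j \<le> k - 1 \<and> x \<in> pverts T"
  "(Apex j, Apex i) \<in> parcs (A_step k T) \<longleftrightarrow> 1 \<le> i \<and> i < j \<and> j \<le> k"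
  "(Apex i, Copy j x) \<in> parcs (A_step k T) \<longleftrightarrow> 1 \<le> i \<and> i \<le> j \<and> j \<le> k - 1 \<and> x \<in> pverts T"
  "(Copy j x, Apex i) \<in> parcs (A_step k T) \<longleftrightarrow> 1 \<le> j \<and> j < i \<and> i \<le> k \<and> x \<in> pverts T"
  "(Copy i x, Copy j y) \<in> parcs (A_step k T) \<longleftrightarrow> 1 \<le> i \<and> j \<le> k - 1 \<and>
    (i = j \<and> (x, y) \<in> parcs T \<or> i < j \<and> x \<in> pverts T \<and> y \<in> pverts T)"
  by (auto simp: A_step_def)

lemma D_step_simps:
  "Apex i \<in> pverts (D_step T) \<longleftrightarrow> i = 1"
  "Copy j x \<in> pverts (D_step T) \<longleftrightarrow> j \<in> {1, 2} \<and> x \<in> pverts T"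
  "(Apex j, Apex i) \<notin> parcs (D_step T)"
  "(Apex i, Copy j x) \<in> parcs (D_step T) \<longleftrightarrow> i = 1 \<and> j = 1 \<and> x \<in> pverts T"
  "(Copy j x, Apex i) \<in> parcs (D_step T) \<longleftrightarrow> i = 1 \<and> j = 2 \<and> x \<in> pverts T"
  "(Copy i x, Copy j y) \<in> parcs (D_step T) \<longleftrightarrow> i = j \<and> j \<in> {1, 2} \<and> (x, y) \<in> parcs T \<or>
    i = 1 \<and> j = 2 \<and> x \<in> pverts T \<and> y \<in> pverts T"
  by (auto simp: D_step_def)

lemma pair_tournamentI:
  assumes "finite (pverts H)"
    and "\<And>a b. (a, b) \<in> parcs H \<Longrightarrow> a \<in> pverts H \<and> b \<in> pverts H \<and> (b, a) \<notin> parcs H"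
    and "\<And>a b. a \<in> pverts H \<Longrightarrow> b \<in> pverts H \<Longrightarrow> a \<noteq> b \<Longrightarrow>
      (a, b) \<in> parcs H \<or> (b, a) \<in> parcs H"
  shows "pair_tournament H"
  unfolding pair_tournament_def total_on_def using assms by (auto intro!: asymI)

lemma pair_tournamentD:
  assumes "pair_tournament H"
  shows "finite (pverts H)"
    and "(a, b) \<in> parcs H \<Longrightarrow> a \<in> pverts H \<and> b \<in> pverts H \<and> (b, a) \<notin> parcs H"
    and "a \<in> pverts H \<Longrightarrow> b \<in> pverts H \<Longrightarrow> a \<noteq> b \<Longrightarrow> (a, b) \<in> parcs H \<or> (b, a) \<in> parcs H"
  using assms unfolding pair_tournament_def total_on_def by (auto dest: asymD)

lemma pair_tournament_A_step:
  assumes "pair_tournament T" shows "pair_tournament (A_step k T)"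
proof (rule pair_tournamentI)
  note H = pair_tournamentD[OF assms]
  show "finite (pverts (A_step k T))" using H(1) by (simp add: A_step_verts)
  show "a \<in> pverts (A_step k T) \<and> b \<in> pverts (A_step k T) \<and> (b, a) \<notin> parcs (A_step k T)"
    if "(a, b) \<in> parcs (A_step k T)" for a b
    using that by (cases a; cases b) (auto simp: A_step_simps dest: H(2))
  show "(a, b) \<in> parcs (A_step k T) \<or> (b, a) \<in> parcs (A_step k T)"
    if "a \<in> pverts (A_step k T)" "b \<in> pverts (A_step k T)" "a \<noteq> b" for a b
    using that by (cases a; cases b) (auto simp: A_step_simps dest: H(3))
qed

lemma pair_tournament_D_step:
  assumes "pair_tournament T" shows "pair_tournament (D_step T)"
proof (rule pair_tournamentI)
  note H = pair_tournamentD[OF assms]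
  show "finite (pverts (D_step T))" using H(1) by (simp add: D_step_verts)
  show "a \<in> pverts (D_step T) \<and> b \<in> pverts (D_step T) \<and> (b, a) \<notin> parcs (D_step T)"
    if "(a, b) \<in> parcs (D_step T)" for a b
  proof (cases a; cases b)
    fix i x j y assume "a = Copy i x" "b = Copy j y"
    from that this consider "i = j" "j \<in> {1, 2}" "(x, y) \<in> parcs T"
      | "i = 1" "j = 2" "x \<in> pverts T" "y \<in> pverts T"
      by (auto simp: D_step_simps)
    then show ?thesis
      using \<open>a = Copy i x\<close> \<open>b = Copy j y\<close> H(2)[of x y] by cases (simp_all add: D_step_simps)
  qed (use that in \<open>auto simp: D_step_simps\<close>)
  show "(a, b) \<in> parcs (D_step T) \<or> (b, a) \<in> parcs (D_step T)"
    if "a \<in> pverts (D_step T)" "b \<in> pverts (D_step T)" "a \<noteq> b" for a b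
    using that by (cases a; cases b) (auto simp: D_step_simps dest: H(3))
qed

lemma pair_tournament_A: "pair_tournament (A_pair k)"
proof (induction k rule: A_pair.induct)
  case (3 k)
  then show ?case by (simp add: pair_tournament_A_step)
qed (auto intro!: pair_tournamentI)

lemma pair_tournament_D: "pair_tournament (D_pair k)"
proof (induction k rule: D_pair.induct)
  case (3 k)
  then show ?case by (simp add: pair_tournament_D_step)
qed (auto intro!: pair_tournamentI)

lemma finite_pverts_A: "finite (pverts (A_pair k))"
  and finite_pverts_D: "finite (pverts (D_pair k))"
  using pair_tournament_A pair_tournament_D by (auto simp: pair_tournament_def)

lemma A_step_card:
  assumes "finite (pverts T)"
  shows "card (pverts (A_step k T)) \<le> k + (k - 1) * card (pverts T)"
proof -
  have "card (pverts (A_step k T)) \<le> card (Apex ` {1..k}) +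
      card ((\<lambda>(j, x). Copy j x) ` ({1..k - 1} \<times> pverts T))"
    unfolding A_step_verts by (rule card_Un_le)
  also have "\<dots> \<le> card {1..k} + card ({1..k - 1} \<times> pverts T)"
    using assms by (intro add_mono card_image_le) auto
  finally show ?thesis by (simp add: card_cartesian_product)
qed

lemma Suc_le_4_fact: "Suc k \<le> 4 * fact k"
  using fact_ge_self[of k] fact_ge_1[of k, where ?'a = nat] by linarith

text \<open>\<open>A_k\<close> has \<open>k\<close> apex vertices and \<open>k - 1\<close> copies of
  \<open>A_(k-1)\<close>. The apex vertices are absorbed by one further summand
  \<open>4 * fact (k - 1)\<close>, and \<open>k\<close> such summands make
  \<open>4 * fact k\<close>.\<close>

lemma card_A_le: "card (pverts (A_pair k)) \<le> 4 * fact k"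
proof (induction k rule: A_pair.induct)
  case (3 k)
  have "card (pverts (A_pair (Suc (Suc k)))) \<le> Suc (Suc k) + Suc k * card (pverts (A_pair (Suc k)))"
    using A_step_card[OF finite_pverts_A, of "Suc (Suc k)" "Suc k"] by simp
  also have "\<dots> \<le> 4 * fact (Suc k) + Suc k * (4 * fact (Suc k))"
    using 3 Suc_le_4_fact[of "Suc k"] by (intro add_mono mult_le_mono2)
  also have "\<dots> = 4 * fact (Suc (Suc k))"
    by (simp add: algebra_simps)
  finally show ?case .
qed auto

lemma card_D_less: "card (pverts (D_pair k)) < 2 ^ k"
proof (induction k rule: D_pair.induct)
  case (3 k)
  have "card (pverts (D_pair (Suc (Suc k)))) \<le>
     card (Copy 1 ` pverts (D_pair (Suc k))) + card (Copy 2 ` pverts (D_pair (Suc k))) + 1"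
    unfolding D_pair.simps D_step_verts
    by (intro order_trans[OF card_Un_le] add_mono) auto
  also have "\<dots> \<le> card (pverts (D_pair (Suc k))) + card (pverts (D_pair (Suc k))) + 1"
    by (intro add_mono card_image_le finite_pverts_D) auto
  finally show ?case using 3 by auto
qed auto

lemma D_pverts_nonempty: "1 \<le> k \<Longrightarrow> pverts (D_pair k) \<noteq> {}"
  by (cases k rule: D_pair.cases) (auto simp: D_step_verts)

section \<open>Bag-chains and zones\<close>

locale finite_tournament_rel =
  fixes V :: "'a set" and E :: "'a rel"
  assumes finite_V: "finite V"
    and E_asym: "(u, v) \<in> E \<Longrightarrow> (v, u) \<notin> E"
    and E_total: "u \<in> V \<Longrightarrow> v \<in> V \<Longrightarrow> u \<noteq> v \<Longrightarrow> (u, v) \<in> E \<or> (v, u) \<in> E"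
begin

lemma finite_sub: "X \<subseteq> V \<Longrightarrow> finite X"
  using finite_V by (rule rev_finite_subset)

text \<open>A vertex splits \<open>B\<close> into its two neighbourhoods and possibly itself, whence
  the extra 1. Used to refute that both neighbourhoods of a vertex in a bag are small.\<close>

lemma omega_le_out_in:
  assumes "v \<in> V" "B \<subseteq> V"
  shows "omega E B \<le> omega E (E `` {v} \<inter> B) + omega E (E\<inverse> `` {v} \<inter> B) + 1"
proof -
  have fin: "finite B" using assms(2) by (rule finite_sub)
  have "omega E B \<le> omega E ((E `` {v} \<inter> B \<union> E\<inverse> `` {v} \<inter> B) \<union> {v})"
    using fin assms E_total by (intro omega_mono) auto
  also have "\<dots> \<le> omega E (E `` {v} \<inter> B \<union> E\<inverse> `` {v} \<inter> B) + omega E {v}"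
    using fin by (intro omega_Un_le) auto
  also have "\<dots> \<le> (omega E (E `` {v} \<inter> B) + omega E (E\<inverse> `` {v} \<inter> B)) + 1"
    using fin omega_card_le[of "{v}" E] by (intro add_mono omega_Un_le) auto
  finally show ?thesis .
qed

lemma omega_Diff_image:
  assumes "X \<subseteq> V" "finite P" "\<And>w. w \<in> f ` P \<Longrightarrow> omega E (F w \<inter> X) < s"
  shows "omega E X \<le> omega E (X - (\<Union>w\<in>f ` P. F w)) + card P * s"
proof -
  have "omega E X \<le> omega E (X - (\<Union>w\<in>f ` P. F w)) + card (f ` P) * s"
    using assms finite_sub by (intro omega_Diff_UN) (auto intro: less_imp_le)
  also have "card (f ` P) * s \<le> card P * s"
    using assms(2) by (simp add: card_image_le)
  finally show ?thesis by simp
qed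

end

section \<open>Consequences of excluding \<open>D_n\<close>, with \<open>s\<close> for
  \<open>c_small\<close> and \<open>L\<close> for \<open>c_large\<close>\<close>

locale D_free_tournament_rel = finite_tournament_rel +
  fixes s L n :: nat
  assumes n_ge: "2 \<le> n"
    and L_ge: "2 ^ n * s \<le> L"
    and no_D: "\<not> hom_into E V (D_pair n) f"
    and large_D: "X \<subseteq> V \<Longrightarrow> s \<le> omega E X \<Longrightarrow> \<exists>f. hom_into E X (D_pair (n - 1)) f"
begin

text \<open>For \<open>s = 0\<close> even the empty set would have to contain the nonempty
  tournament \<open>D_(n-1)\<close>.\<close>

lemma s_pos: "0 < s"
proof (rule ccontr)
  have n1: "1 \<le> n - 1" using n_ge by simp
  assume "\<not> 0 < s"
  then obtain f where "hom_into E {} (D_pair (n - 1)) f"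
    using large_D[of "{}"] by auto
  then show False
    using D_pverts_nonempty[OF n1] by (auto simp: hom_into_def)
qed

text \<open>A bag cannot be split by a vertex into a part below \<open>2 ^ (n - 1) * s\<close> and a
  part below \<open>s\<close>: the two strict inequalities leave room for the vertex itself.\<close>

lemma L_ge': "2 ^ (n - 1) * s + s \<le> L"
proof -
  have "2 ^ (n - 1) * s + s \<le> 2 ^ (n - 1) * s + 2 ^ (n - 1) * s" by simp
  also have "\<dots> = 2 ^ n * s"
    using n_ge by (cases n) auto
  finally show ?thesis using L_ge by simp
qed

text \<open>The cyclic pattern from \<open>v\<close> to \<open>X\<close> to \<open>Y\<close> and
  back to \<open>v\<close> is the one that builds \<open>D_n\<close>: \<open>v\<close> is the apex,
  the copy in \<open>X\<close> is the first one and the copy in \<open>Y\<close> the second.\<close>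

lemma no_D_split:
  assumes "hom_into E X (D_pair (n - 1)) f" "hom_into E Y (D_pair (n - 1)) g"
    and "v \<in> V" "X \<subseteq> V" "Y \<subseteq> V"
    and vX: "\<And>x. x \<in> X \<Longrightarrow> (v, x) \<in> E" and Yv: "\<And>y. y \<in> Y \<Longrightarrow> (y, v) \<in> E"
    and XY: "\<And>x y. x \<in> X \<Longrightarrow> y \<in> Y \<Longrightarrow> (x, y) \<in> E"
  shows False
proof -
  define D where "D = D_pair (n - 1)"
  obtain k where k: "n = Suc (Suc k)"
    using n_ge by (metis Suc_le_D numeral_2_eq_2 Suc_le_mono)
  then have Dn: "D_pair n = D_step D" by (simp add: D_def)
  define h where "h = case_vertex (\<lambda>_. v) (\<lambda>j x. if j = 1 then f x else g x)"
  have h: "h (Apex i) = v" "h (Copy j x) = (if j = 1 then f x else g x)" for i j x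
    by (simp_all add: h_def)
  have f: "f x \<in> X" "g x \<in> Y" if "x \<in> pverts D" for x
    using assms(1,2) that by (auto simp: hom_into_def D_def)
  have arc: "(f x, f y) \<in> E" "(g x, g y) \<in> E" if "(x, y) \<in> parcs D" for x y
    using assms(1,2) that by (auto simp: hom_into_def D_def)
  have "h a \<in> V" if "a \<in> pverts (D_pair n)" for a
    using that f assms(3-5) unfolding Dn by (cases a) (auto simp: D_step_simps h)
  moreover have "(h a, h b) \<in> E" if "(a, b) \<in> parcs (D_pair n)" for a b
    using that f unfolding Dn
    by (cases a; cases b) (auto simp: D_step_simps h vX Yv XY dest: arc)
  ultimately have "hom_into E V (D_pair n) h"
    by (auto simp: hom_into_def)
  then show False using no_D by blast
qed

text \<open>Take a copy \<open>W\<close> of \<open>D_(n-1)\<close> in the out-neighbourhood of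
  \<open>v\<close> in \<open>A\<close>. Inside the in-neighbourhood of \<open>v\<close> in
  \<open>B\<close>, delete all in-neighbours of \<open>W\<close>; if the set was huge, a second copy
  survives, dominated by \<open>W\<close> and dominating \<open>v\<close>.\<close>

lemma omega_in_nbhd_less:
  assumes "v \<in> V" "A \<subseteq> V" "B \<subseteq> V" and large: "s \<le> omega E (E `` {v} \<inter> A)"
    and small: "\<And>w. w \<in> A \<Longrightarrow> omega E (E\<inverse> `` {w} \<inter> B) < s"
  shows "omega E (E\<inverse> `` {v} \<inter> B) < 2 ^ (n - 1) * s"
proof (rule ccontr)
  assume *: "\<not> ?thesis"
  let ?D = "D_pair (n - 1)" and ?X = "E\<inverse> `` {v} \<inter> B"
  obtain f where f: "hom_into E (E `` {v} \<inter> A) ?D f"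
    using large_D[OF _ large] assms(2) by blast
  define W where "W = f ` pverts ?D"
  have W: "W \<subseteq> E `` {v} \<inter> A" using f by (auto simp: W_def hom_into_def)
  let ?R = "?X - (\<Union>w\<in>W. E\<inverse> `` {w})"
  have "omega E (E\<inverse> `` {w} \<inter> ?X) < s" if "w \<in> W" for w
  proof -
    have "omega E (E\<inverse> `` {w} \<inter> ?X) \<le> omega E (E\<inverse> `` {w} \<inter> B)"
      using finite_sub[OF assms(3)] by (intro omega_mono) auto
    with small[of w] W that show ?thesis by auto
  qed
  then have "omega E ?X \<le> omega E ?R + card (pverts ?D) * s"
    unfolding W_def using assms(3) by (intro omega_Diff_image finite_pverts_D) auto
  \<comment> \<open>Fewer than \<open>2 ^ (n - 1)\<close> deletions costing at most \<open>s\<close>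
    each still leave \<open>s\<close>.\<close>
  moreover have "Suc (card (pverts ?D)) * s \<le> 2 ^ (n - 1) * s"
    using card_D_less[of "n - 1"] by (intro mult_le_mono1) simp
  ultimately have "s \<le> omega E ?R" using * by simp
  then obtain g where g: "hom_into E ?R ?D g"
    using large_D[of ?R] assms(3) by blast
  have "hom_into E W ?D f" using f by (auto simp: W_def hom_into_def)
  from this g show False
  proof (rule no_D_split[of W f ?R g v])
    fix x y assume xy: "x \<in> W" "y \<in> ?R"
    then have "(v, x) \<in> E" "(y, v) \<in> E" "(y, x) \<notin> E" "x \<in> V" "y \<in> V"
      using W assms(2,3) by auto
    then show "(x, y) \<in> E" using E_total[of x y] E_asym by blast
  qed (use W assms in auto)
qed

text \<open>The mirror image: the copy found first, among the in-neighbours of \<open>v\<close> in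
  \<open>B\<close>, now serves as the second copy of \<open>D_n\<close>.\<close>

lemma omega_out_nbhd_less:
  assumes "v \<in> V" "A \<subseteq> V" "B \<subseteq> V" and large: "s \<le> omega E (E\<inverse> `` {v} \<inter> B)"
    and small: "\<And>w. w \<in> B \<Longrightarrow> omega E (E `` {w} \<inter> A) < s"
  shows "omega E (E `` {v} \<inter> A) < 2 ^ (n - 1) * s"
proof (rule ccontr)
  assume *: "\<not> ?thesis"
  let ?D = "D_pair (n - 1)" and ?X = "E `` {v} \<inter> A"
  obtain f where f: "hom_into E (E\<inverse> `` {v} \<inter> B) ?D f"
    using large_D[OF _ large] assms(3) by blast
  define W where "W = f ` pverts ?D"
  have W: "W \<subseteq> E\<inverse> `` {v} \<inter> B" using f by (auto simp: W_def hom_into_def)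
  let ?R = "?X - (\<Union>w\<in>W. E `` {w})"
  have "omega E (E `` {w} \<inter> ?X) < s" if "w \<in> W" for w
  proof -
    have "omega E (E `` {w} \<inter> ?X) \<le> omega E (E `` {w} \<inter> A)"
      using finite_sub[OF assms(2)] by (intro omega_mono) auto
    with small[of w] W that show ?thesis by auto
  qed
  then have "omega E ?X \<le> omega E ?R + card (pverts ?D) * s"
    unfolding W_def using assms(2) by (intro omega_Diff_image finite_pverts_D) auto
  moreover have "Suc (card (pverts ?D)) * s \<le> 2 ^ (n - 1) * s"
    using card_D_less[of "n - 1"] by (intro mult_le_mono1) simp
  ultimately have "s \<le> omega E ?R" using * by simp
  then obtain g where g: "hom_into E ?R ?D g"
    using large_D[of ?R] assms(2) by blast
  have "hom_into E W ?D f" using f by (auto simp: W_def hom_into_def)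
  from g this show False
  proof (rule no_D_split[of ?R g W f v])
    fix x y assume xy: "x \<in> ?R" "y \<in> W"
    then have "(v, x) \<in> E" "(y, v) \<in> E" "(y, x) \<notin> E" "x \<in> V" "y \<in> V"
      using W assms(2,3) by auto
    then show "(x, y) \<in> E" using E_total[of x y] E_asym by blast
  qed (use W assms in auto)
qed

text \<open>The bag \<open>B\<close> separates \<open>x\<close> from \<open>Y\<close>. A large
  in-neighbourhood of \<open>x\<close> in \<open>Y\<close> would bound its out-neighbourhood in
  \<open>B\<close> by \<open>omega_out_nbhd_less\<close>; the in-neighbourhood of \<open>x\<close>
  in \<open>B\<close> is small as well, so \<open>B\<close> would fall below
  \<open>L\<close>.\<close>

lemma omega_in_nbhd_across:
  assumes "x \<in> V" "Y \<subseteq> V" "B \<subseteq> V" "omega E B = L"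
    and "omega E (E\<inverse> `` {x} \<inter> B) < s" and "\<And>y. y \<in> Y \<Longrightarrow> omega E (E `` {y} \<inter> B) < s"
  shows "omega E (E\<inverse> `` {x} \<inter> Y) < s"
proof (rule ccontr)
  assume "\<not> ?thesis"
  then have "omega E (E `` {x} \<inter> B) < 2 ^ (n - 1) * s"
    using assms by (intro omega_out_nbhd_less[of x B Y]) auto
  then show False
    using omega_le_out_in[OF assms(1,3)] assms(4,5) L_ge' by linarith
qed

lemma omega_out_nbhd_across:
  assumes "y \<in> V" "X \<subseteq> V" "B \<subseteq> V" "omega E B = L"
    and "omega E (E `` {y} \<inter> B) < s" and "\<And>x. x \<in> X \<Longrightarrow> omega E (E\<inverse> `` {x} \<inter> B) < s"
  shows "omega E (E `` {y} \<inter> X) < s"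
proof (rule ccontr)
  assume "\<not> ?thesis"
  then have "omega E (E\<inverse> `` {y} \<inter> B) < 2 ^ (n - 1) * s"
    using assms by (intro omega_in_nbhd_less[of y X B]) auto
  then show False
    using omega_le_out_in[OF assms(1,3)] assms(4,5) L_ge' by linarith
qed

section \<open>Chains of bags and the position of a vertex relative to a chain\<close>

definition precedes :: "'a set \<Rightarrow> 'a set \<Rightarrow> bool" where
  "precedes X Y \<longleftrightarrow> (\<forall>v\<in>Y. omega E (E `` {v} \<inter> X) < s) \<and> (\<forall>w\<in>X. omega E (E\<inverse> `` {w} \<inter> Y) < s)"

definition chain :: "'a set list \<Rightarrow> bool" where
  "chain Bs \<longleftrightarrow> sorted_wrt precedes Bs \<and> (\<forall>B\<in>set Bs. B \<subseteq> V \<and> omega E B = L)"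

text \<open>A vertex of \<open>B\<close> would have two small neighbourhoods in \<open>B\<close>.
  Hence the bags of a chain are distinct, which bounds the length of chains and gives a longest
  one.\<close>

lemma not_precedes_refl:
  assumes "B \<subseteq> V" "omega E B = L"
  shows "\<not> precedes B B"
proof
  assume "precedes B B"
  have "B \<noteq> {}" using assms(2) L_ge' s_pos by auto
  then obtain v where "v \<in> B" by blast
  with \<open>precedes B B\<close> have "omega E (E `` {v} \<inter> B) < s" "omega E (E\<inverse> `` {v} \<inter> B) < s"
    by (auto simp: precedes_def)
  moreover have "s \<le> 2 ^ (n - 1) * s" by simp
  ultimately show False
    using omega_le_out_in[OF subsetD[OF assms(1) \<open>v \<in> B\<close>] assms(1)] assms(2) L_ge' by linarith
qed

lemma chain_nth:
  assumes "chain Bs" "i < length Bs"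
  shows "Bs ! i \<subseteq> V" "omega E (Bs ! i) = L"
  using assms by (auto simp: chain_def)

lemma chain_precedes: "chain Bs \<Longrightarrow> i < j \<Longrightarrow> j < length Bs \<Longrightarrow> precedes (Bs ! i) (Bs ! j)"
  by (simp add: chain_def sorted_wrt_nth_less)

lemma chain_length_le:
  assumes "chain Bs"
  shows "length Bs \<le> card (Pow V)"
proof -
  have "distinct Bs"
    unfolding distinct_conv_nth
    by (metis assms chain_nth chain_precedes linorder_neqE_nat not_precedes_refl)
  then have "length Bs = card (set Bs)" by (simp add: distinct_card)
  also have "\<dots> \<le> card (Pow V)"
    using assms finite_V by (intro card_mono) (auto simp: chain_def)
  finally show ?thesis .
qed

text \<open>The first bag in which \<open>v\<close> has a large out-neighbourhood. The guard
  \<open>i < length Bs\<close> makes the condition true at \<open>length Bs\<close>, which is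
  therefore the zone of a vertex with no such bag.\<close>

definition zone :: "'a set list \<Rightarrow> 'a \<Rightarrow> nat" where
  "zone Bs v = (LEAST i. i < length Bs \<longrightarrow> s \<le> omega E (E `` {v} \<inter> Bs ! i))"

lemma zone_le_length: "zone Bs v \<le> length Bs"
  unfolding zone_def by (rule Least_le) simp

lemma omega_out_before_zone: "j < zone Bs v \<Longrightarrow> omega E (E `` {v} \<inter> Bs ! j) < s"
  unfolding zone_def by (drule not_less_Least) simp

lemma omega_out_zone: "zone Bs v < length Bs \<Longrightarrow> s \<le> omega E (E `` {v} \<inter> Bs ! zone Bs v)"
  using LeastI[of "\<lambda>i. i < length Bs \<longrightarrow> s \<le> omega E (E `` {v} \<inter> Bs ! i)" "length Bs"]
  unfolding zone_def by simp

text \<open>The bag right after the zone of \<open>v\<close> would be too small: the large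
  out-neighbourhood in the zone's bag bounds the in-neighbourhood there, and a large
  in-neighbourhood in bag \<open>j\<close> would bound the out-neighbourhood there. Both bounds are
  \<open>2 ^ (n - 1) * s\<close>, which is where \<open>2 ^ n * s\<close> comes from.\<close>

lemma omega_in_after_zone:
  assumes "chain Bs" "v \<in> V" "zone Bs v + 2 \<le> j" "j < length Bs"
  shows "omega E (E\<inverse> `` {v} \<inter> Bs ! j) < s"
proof (rule ccontr)
  assume large: "\<not> ?thesis"
  let ?i = "zone Bs v"
  have "omega E (E\<inverse> `` {v} \<inter> Bs ! Suc ?i) < 2 ^ (n - 1) * s"
    using assms omega_out_zone[of Bs v] chain_precedes[OF assms(1), of ?i "Suc ?i"]
    by (intro omega_in_nbhd_less[of v "Bs ! ?i"] chain_nth) (auto simp: precedes_def)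
  moreover have "omega E (E `` {v} \<inter> Bs ! Suc ?i) < 2 ^ (n - 1) * s"
    using assms large chain_precedes[OF assms(1), of "Suc ?i" j]
    by (intro omega_out_nbhd_less[of v _ "Bs ! j"] chain_nth) (auto simp: precedes_def)
  moreover have "L \<le> omega E (E `` {v} \<inter> Bs ! Suc ?i) + omega E (E\<inverse> `` {v} \<inter> Bs ! Suc ?i) + 1"
    using omega_le_out_in[OF assms(2) chain_nth(1)[OF assms(1)], of "Suc ?i"]
      chain_nth(2)[OF assms(1), of "Suc ?i"] assms(3,4) by simp
  moreover have "2 ^ n * s = 2 ^ (n - 1) * s + 2 ^ (n - 1) * s"
    using n_ge by (cases n) auto
  ultimately show False using L_ge by linarith
qed

text \<open>A gap of 3 leaves a bag that is at least two places after the lower zone and strictly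
  before the upper one. It is chosen from the single vertex, as bag \<open>zone Bs x + 2\<close> or
  bag \<open>zone Bs y - 1\<close>, so that it serves for the whole set on the other side.\<close>

lemma zone_separation:
  assumes "chain Bs"
  shows "x \<in> V \<Longrightarrow> Y \<subseteq> V \<Longrightarrow> (\<And>y. y \<in> Y \<Longrightarrow> zone Bs x + 3 \<le> zone Bs y) \<Longrightarrow>
      omega E (E\<inverse> `` {x} \<inter> Y) < s"
    and "y \<in> V \<Longrightarrow> X \<subseteq> V \<Longrightarrow> (\<And>x. x \<in> X \<Longrightarrow> zone Bs x + 3 \<le> zone Bs y) \<Longrightarrow>
      omega E (E `` {y} \<inter> X) < s"
proof -
  assume *: "x \<in> V" "Y \<subseteq> V" "\<And>y. y \<in> Y \<Longrightarrow> zone Bs x + 3 \<le> zone Bs y"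
  show "omega E (E\<inverse> `` {x} \<inter> Y) < s"
  proof (cases "Y = {}")
    case False
    then obtain y where "y \<in> Y" by blast
    \<comment> \<open>Zones never exceed \<open>length Bs\<close>, so the separating bag
      exists.\<close>
    then have "zone Bs x + 2 < length Bs"
      using *(3) zone_le_length[of Bs y] by fastforce
    then show ?thesis
      using * assms
      by (intro omega_in_nbhd_across[of x Y "Bs ! (zone Bs x + 2)"] chain_nth omega_in_after_zone
          omega_out_before_zone) fastforce+
  qed (simp add: s_pos)
next
  assume *: "y \<in> V" "X \<subseteq> V" "\<And>x. x \<in> X \<Longrightarrow> zone Bs x + 3 \<le> zone Bs y"
  show "omega E (E `` {y} \<inter> X) < s"
  proof (cases "X = {}")
    case False
    then have len: "zone Bs y - 1 < length Bs" "0 < zone Bs y"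
      using *(3) zone_le_length[of Bs y] by fastforce+
    show ?thesis
    proof (rule omega_out_nbhd_across[of y X "Bs ! (zone Bs y - 1)"])
      fix x assume "x \<in> X"
      then show "omega E (E\<inverse> `` {x} \<inter> Bs ! (zone Bs y - 1)) < s"
        using * assms len by (intro omega_in_after_zone) fastforce+
    qed (use * assms len in \<open>simp_all add: chain_nth omega_out_before_zone\<close>)
  qed (simp add: s_pos)
qed

text \<open>
  Of the bags near zone \<open>i\<close>, the bags \<open>i - 1\<close> and \<open>i + 2\<close> are dropped as well: they are the
  separating bags which make the remaining old bags comparable with the new ones.
\<close>

lemma chain_insert_zone:
  assumes Bs: "chain Bs" and Cs: "chain Cs"
    and sub: "\<And>C. C \<in> set Cs \<Longrightarrow> C \<subseteq> {v \<in> V. zone Bs v = i}"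
  shows "chain (take (i - 1) Bs @ Cs @ drop (i + 3) Bs)"
proof -
  have left: "precedes B C" if B: "B \<in> set (take (i - 1) Bs)" and C: "C \<in> set Cs" for B C
  proof -
    obtain j where j: "j < i - 1" "j < length Bs" "B = Bs ! j"
      using B by (auto simp: in_set_conv_nth)
    show ?thesis
    proof (cases "C = {}")
      case False
      then obtain c where "c \<in> C" by blast
      then have i: "i \<le> length Bs" using sub[OF C] zone_le_length[of Bs] by blast
      have CV: "C \<subseteq> V" using sub[OF C] by blast
      show ?thesis
        unfolding precedes_def
      proof (intro conjI ballI)
        show "omega E (E `` {v} \<inter> B) < s" if "v \<in> C" for v
          using j sub[OF C] that by (auto intro!: omega_out_before_zone)
        show "omega E (E\<inverse> `` {w} \<inter> C) < s" if w: "w \<in> B" for w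
        proof (rule omega_in_nbhd_across[of w C "Bs ! (i - 1)"])
          show "w \<in> V" using chain_nth[OF Bs j(2)] w j(3) by blast
          show "omega E (E\<inverse> `` {w} \<inter> Bs ! (i - 1)) < s"
            using chain_precedes[OF Bs j(1)] i j w by (auto simp: precedes_def)
          show "omega E (E `` {y} \<inter> Bs ! (i - 1)) < s" if "y \<in> C" for y
            using j sub[OF C] that by (intro omega_out_before_zone) auto
        qed (use i j CV Bs in \<open>simp_all add: chain_nth\<close>)
      qed
    qed (simp add: precedes_def s_pos)
  qed
  have right: "precedes C B" if B: "B \<in> set (drop (i + 3) Bs)" and C: "C \<in> set Cs" for B C
  proof -
    obtain k where "k < length Bs - (i + 3)" "B = Bs ! (i + 3 + k)"
      using B by (auto simp: in_set_conv_nth add.commute add.left_commute)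
    then obtain j where j: "i + 3 \<le> j" "j < length Bs" "B = Bs ! j"
      by (metis le_add1 less_diff_conv add.commute)
    have CV: "C \<subseteq> V" using sub[OF C] by blast
    show ?thesis
      unfolding precedes_def
    proof (intro conjI ballI)
      show "omega E (E\<inverse> `` {v} \<inter> B) < s" if "v \<in> C" for v
        using j sub[OF C] that by (auto intro!: omega_in_after_zone[OF Bs])
      show "omega E (E `` {w} \<inter> C) < s" if w: "w \<in> B" for w
      proof (rule omega_out_nbhd_across[of w C "Bs ! (i + 2)"])
        show "w \<in> V" using chain_nth[OF Bs j(2)] w j(3) by blast
        show "omega E (E `` {w} \<inter> Bs ! (i + 2)) < s"
          using chain_precedes[OF Bs, of "i + 2" j] j w by (auto simp: precedes_def)
        show "omega E (E\<inverse> `` {x} \<inter> Bs ! (i + 2)) < s" if "x \<in> C" for x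
          using j sub[OF C] that by (intro omega_in_after_zone[OF Bs]) auto
      qed (use j CV Bs in \<open>simp_all add: chain_nth\<close>)
    qed
  qed
  have old: "precedes A B" if A: "A \<in> set (take (i - 1) Bs)" and B: "B \<in> set (drop (i + 3) Bs)" for A B
  proof -
    have "sorted_wrt precedes (take (i - 1) Bs @ drop (i - 1) Bs)"
      using Bs by (simp add: chain_def)
    moreover have "B \<in> set (drop (i - 1) Bs)"
      using B by (rule subsetD[OF set_drop_subset_set_drop, rotated]) simp
    ultimately show ?thesis using A unfolding sorted_wrt_append by blast
  qed
  show ?thesis
    using Bs Cs left right old
    unfolding chain_def sorted_wrt_append
    by (auto simp: sorted_wrt_take sorted_wrt_drop dest: in_set_takeD in_set_dropD)
qed

lemma ex_chain_small_zones:
  assumes "\<And>X. X \<subseteq> V \<Longrightarrow> K \<le> omega E X \<Longrightarrow> \<exists>Cs. length Cs = 8 \<and> chain Cs \<and> (\<forall>C\<in>set Cs. C \<subseteq> X)"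
  obtains Bs where "chain Bs" "\<And>i. omega E {v \<in> V. zone Bs v = i} < K"
proof -
  have "chain []" by (simp add: chain_def)
  then have "\<exists>Bs. chain Bs \<and> (\<forall>Cs. chain Cs \<longrightarrow> length Cs \<le> length Bs)"
    by (rule ex_has_greatest_nat[where b = "Suc (card (Pow V))"])
      (simp add: chain_length_le less_Suc_eq_le del: card_Pow)
  then obtain Bs where Bs: "chain Bs" and max: "\<And>Cs. chain Cs \<Longrightarrow> length Cs \<le> length Bs"
    by blast
  have "omega E {v \<in> V. zone Bs v = i} < K" for i
  proof (rule ccontr)
    assume "\<not> ?thesis"
    then have large: "K \<le> omega E {v \<in> V. zone Bs v = i}" by simp
    obtain Cs where Cs: "length Cs = 8" "chain Cs"
      "\<And>C. C \<in> set Cs \<Longrightarrow> C \<subseteq> {v \<in> V. zone Bs v = i}"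
      using assms[OF _ large] by blast
    \<comment> \<open>Bags are nonempty, so zone \<open>i\<close> is inhabited and \<open>i\<close>
      is at most \<open>length Bs\<close>. At most the four bags \<open>i - 1\<close> to
      \<open>i + 2\<close> are lost, against eight gained.\<close>
    have "C \<noteq> {}" if "C \<in> set Cs" for C
      using Cs(2) that L_ge' s_pos by (auto simp: chain_def)
    moreover obtain C where "C \<in> set Cs" using Cs(1) by (cases Cs) auto
    ultimately have "i \<le> length Bs" using Cs(3) zone_le_length[of Bs] by blast
    with max[OF chain_insert_zone[OF Bs Cs(2,3)]] Cs(1) show False by simp
  qed
  with Bs show thesis by (rule that)
qed

end

section \<open>Blocks of zones\<close>

text \<open>Add the zones one after another to the current last block, and open a new block once
  that one has reached \<open>M\<close>. A block still below \<open>M\<close> grows by at most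
  \<open>M\<close>, and every block but the last has reached \<open>M\<close>.\<close>

lemma ex_blocks:
  fixes \<zeta> :: "'a \<Rightarrow> nat"
  assumes "finite V" "\<And>i. omega E {x \<in> V. \<zeta> x = i} \<le> M"
  obtains \<beta> :: "'a \<Rightarrow> nat" where
    "\<And>x y. x \<in> V \<Longrightarrow> y \<in> V \<Longrightarrow> \<beta> x < \<beta> y \<Longrightarrow> \<zeta> x < \<zeta> y"
    "\<And>b. omega E {x \<in> V. \<beta> x = b} \<le> 2 * M"
    "\<And>y b. y \<in> V \<Longrightarrow> b < \<beta> y \<Longrightarrow> M \<le> omega E {x \<in> V. \<beta> x = b}"
proof -
  define U where "U N = {x \<in> V. \<zeta> x < N}" for N
  have "\<exists>(\<beta> :: 'a \<Rightarrow> nat) l. (\<forall>x\<in>U N. \<forall>y\<in>U N. \<beta> x < \<beta> y \<longrightarrow> \<zeta> x < \<zeta> y) \<and> (\<forall>x\<in>U N. \<beta> x \<le> l) \<and>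
      (\<forall>b. omega E {x \<in> U N. \<beta> x = b} \<le> 2 * M) \<and> (\<forall>b<l. M \<le> omega E {x \<in> U N. \<beta> x = b})" for N
  proof (induction N)
    case 0
    have "U 0 = {}" by (simp add: U_def)
    then show ?case by (intro exI[of _ "\<lambda>_. 0"] exI[of _ 0]) simp
  next
    case (Suc N)
    then obtain \<beta> :: "'a \<Rightarrow> nat" and l where IH: "\<And>x y. x \<in> U N \<Longrightarrow> y \<in> U N \<Longrightarrow> \<beta> x < \<beta> y \<Longrightarrow> \<zeta> x < \<zeta> y"
      "\<And>x. x \<in> U N \<Longrightarrow> \<beta> x \<le> l" "\<And>b. omega E {x \<in> U N. \<beta> x = b} \<le> 2 * M"
      "\<And>b. b < l \<Longrightarrow> M \<le> omega E {x \<in> U N. \<beta> x = b}"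
      by blast
    \<comment> \<open>The block that receives zone \<open>N\<close>: the last block if it is still
      below \<open>M\<close>, otherwise a fresh one.\<close>
    define l' where "l' = (if M \<le> omega E {x \<in> U N. \<beta> x = l} then Suc l else l)"
    define \<beta>' where "\<beta>' x = (if \<zeta> x < N then \<beta> x else l')" for x
    have l': "l \<le> l'" by (simp add: l'_def)
    have U: "U (Suc N) = U N \<union> {x \<in> V. \<zeta> x = N}" by (auto simp: U_def)
    have old: "{x \<in> U (Suc N). \<beta>' x = b} = {x \<in> U N. \<beta> x = b}" if "b \<noteq> l'" for b
      using that by (auto simp: U_def \<beta>'_def)
    have "omega E {x \<in> U N. \<beta> x = l'} \<le> M"
    proof (cases "l' = l")
      case True
      then show ?thesis by (auto simp: l'_def split: if_splits)
    next
      case False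
      then have empty: "{x \<in> U N. \<beta> x = l'} = {}" using IH(2) l' by fastforce
      show ?thesis unfolding empty by simp
    qed
    moreover have "{x \<in> U (Suc N). \<beta>' x = l'} = {x \<in> U N. \<beta> x = l'} \<union> {x \<in> V. \<zeta> x = N}"
      by (auto simp: U_def \<beta>'_def)
    moreover have "omega E ({x \<in> U N. \<beta> x = l'} \<union> {x \<in> V. \<zeta> x = N}) \<le>
        omega E {x \<in> U N. \<beta> x = l'} + omega E {x \<in> V. \<zeta> x = N}"
      using assms(1) by (intro omega_Un_le) (auto simp: U_def)
    ultimately have new: "omega E {x \<in> U (Suc N). \<beta>' x = l'} \<le> 2 * M"
      using assms(2)[of N] by simp
    have 1: "\<zeta> x < \<zeta> y" if "x \<in> U (Suc N)" "y \<in> U (Suc N)" "\<beta>' x < \<beta>' y" for x y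
      using that IH(1)[of x y] IH(2)[of y] l'
      by (auto simp: U_def \<beta>'_def split: if_splits)
    have 2: "\<beta>' x \<le> l'" if "x \<in> U (Suc N)" for x
      using that IH(2)[of x] l' by (auto simp: U_def \<beta>'_def)
    have 3: "omega E {x \<in> U (Suc N). \<beta>' x = b} \<le> 2 * M" for b
      using new old[of b] IH(3)[of b] by (cases "b = l'") auto
    have 4: "M \<le> omega E {x \<in> U (Suc N). \<beta>' x = b}" if "b < l'" for b
      using that IH(4)[of b] by (cases "b = l") (auto simp: old l'_def split: if_splits)
    show ?case using 1 2 3 4 by blast
  qed
  \<comment> \<open>At this stage all inhabited zones have been distributed.\<close>
  note blocks = this[of "Suc (Max (\<zeta> ` V))"]
  have "U (Suc (Max (\<zeta> ` V))) = V"
    using assms(1) by (auto simp: U_def less_Suc_eq_le)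
  from blocks[unfolded this] obtain \<beta> :: "'a \<Rightarrow> nat" and l where \<beta>:
    "\<And>x y. x \<in> V \<Longrightarrow> y \<in> V \<Longrightarrow> \<beta> x < \<beta> y \<Longrightarrow> \<zeta> x < \<zeta> y"
    "\<And>x. x \<in> V \<Longrightarrow> \<beta> x \<le> l" "\<And>b. omega E {x \<in> V. \<beta> x = b} \<le> 2 * M"
    "\<And>b. b < l \<Longrightarrow> M \<le> omega E {x \<in> V. \<beta> x = b}"
    by blast
  show thesis
    using \<beta>(1,3) by (rule that) (use \<beta>(2,4) in \<open>auto intro: less_le_trans\<close>)
qed

text \<open>Take the largest element \<open>b\<close> and discard everything closer than
  \<open>d\<close> to it. This removes at most \<open>d\<close> elements, and the rest is treated by
  induction.\<close>

lemma ex_spaced_subset: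
  assumes "0 < d" "finite S" "d * m \<le> card S"
  shows "\<exists>g :: nat \<Rightarrow> nat. (\<forall>i\<in>{1..m}. g i \<in> S) \<and> (\<forall>i j. 1 \<le> i \<and> i < j \<and> j \<le> m \<longrightarrow> g i + d \<le> g j)"
  using assms(2,3)
proof (induction m arbitrary: S)
  case (Suc m)
  define b where "b = Max S"
  define S' where "S' = {x \<in> S. x + d \<le> b}"
  have "card S > 0" using Suc.prems assms(1) by (intro less_le_trans[OF _ Suc.prems(2)]) simp
  then have "b \<in> S" unfolding b_def using Suc.prems(1) by (intro Max_in) auto
  have "S - S' \<subseteq> {b + 1 - d..<b + 1}"
    using Suc.prems(1) by (auto simp: S'_def b_def less_Suc_eq_le)
  then have "card (S - S') \<le> card {b + 1 - d..<b + 1}" by (intro card_mono) auto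
  then have "card (S - S') \<le> d" by simp
  moreover have "card S = card S' + card (S - S')"
    using Suc.prems(1) by (subst card_Diff_subset) (auto simp: S'_def card_mono)
  ultimately have "d * m \<le> card S'" using Suc.prems(2) by simp
  then obtain g where g: "\<And>i. i \<in> {1..m} \<Longrightarrow> g i \<in> S'"
    "\<And>i j. 1 \<le> i \<Longrightarrow> i < j \<Longrightarrow> j \<le> m \<Longrightarrow> g i + d \<le> g j"
    using Suc.IH[of S'] finite_subset[OF _ Suc.prems(1), of S'] unfolding S'_def by blast
  define g' where "g' = g(Suc m := b)"
  have "g' i \<in> S" if "i \<in> {1..Suc m}" for i
    using that \<open>b \<in> S\<close> g(1)[of i] by (cases "i = Suc m") (auto simp: g'_def S'_def)
  moreover have "g' i + d \<le> g' j" if "1 \<le> i" "i < j" "j \<le> Suc m" for i j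
    using that g(1)[of i] g(2)[of i j] by (cases "j = Suc m") (auto simp: g'_def S'_def)
  ultimately show ?case by blast
qed simp

section \<open>Completing a backward path to a copy of \<open>A_m\<close>\<close>

context finite_tournament_rel
begin

text \<open>The \<open>v i\<close> become the apex vertices. Copies of \<open>A_(m-1)\<close> are
  chosen in \<open>P 1\<close>, \<open>P 2\<close> and so on; before each choice the unwanted
  neighbourhoods of all \<open>v i\<close> and of all vertices of earlier copies are deleted. There
  are at most \<open>4 * fact m\<close> of them, each below \<open>s\<close>, so the remainder still
  has clique number at least \<open>s\<close>.\<close>

lemma A_copy_from_backward_path:
  fixes v :: "nat \<Rightarrow> 'a" and P :: "nat \<Rightarrow> 'a set"
  assumes m: "2 \<le> m"
    and large_A: "\<And>X. X \<subseteq> V \<Longrightarrow> s \<le> omega E X \<Longrightarrow> \<exists>f. hom_into E X (A_pair (m - 1)) f"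
    and v: "\<And>i. 1 \<le> i \<Longrightarrow> i \<le> m \<Longrightarrow> v i \<in> V"
    and P: "\<And>j. 1 \<le> j \<Longrightarrow> j < m \<Longrightarrow> P j \<subseteq> V"
    and vv: "\<And>i j. 1 \<le> i \<Longrightarrow> i < j \<Longrightarrow> j \<le> m \<Longrightarrow> (v j, v i) \<in> E"
    and vP: "\<And>i j. 1 \<le> i \<Longrightarrow> i \<le> m \<Longrightarrow> 1 \<le> j \<Longrightarrow> j < m \<Longrightarrow> v i \<notin> P j"
    and PP: "\<And>i j. 1 \<le> i \<Longrightarrow> i < j \<Longrightarrow> j < m \<Longrightarrow> P i \<inter> P j = {}"
    and vP_in: "\<And>i j. 1 \<le> i \<Longrightarrow> i \<le> j \<Longrightarrow> j < m \<Longrightarrow> omega E (E\<inverse> `` {v i} \<inter> P j) < s"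
    and vP_out: "\<And>i j. 1 \<le> j \<Longrightarrow> j < i \<Longrightarrow> i \<le> m \<Longrightarrow> omega E (E `` {v i} \<inter> P j) < s"
    and PP_in: "\<And>i j x. 1 \<le> i \<Longrightarrow> i < j \<Longrightarrow> j < m \<Longrightarrow> x \<in> P i \<Longrightarrow> omega E (E\<inverse> `` {x} \<inter> P j) < s"
    and P_large: "\<And>j. 1 \<le> j \<Longrightarrow> j < m \<Longrightarrow> (4 * fact m + 1) * s \<le> omega E (P j)"
  shows "\<exists>f. hom_into E V (A_pair m) f"
proof -
  define A where "A = A_pair (m - 1)"
  \<comment> \<open>All arcs of \<open>A_m\<close> that end or start in copy \<open>j\<close>,
    except those to later copies, which are ensured when the later copy is chosen.\<close>
  define good where "good F j \<longleftrightarrow> hom_into E (P j) A (F j) \<and>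
      (\<forall>x\<in>pverts A. (\<forall>i. 1 \<le> i \<and> i \<le> j \<longrightarrow> (v i, F j x) \<in> E) \<and>
        (\<forall>i. j < i \<and> i \<le> m \<longrightarrow> (F j x, v i) \<in> E) \<and>
        (\<forall>i y. 1 \<le> i \<and> i < j \<and> y \<in> pverts A \<longrightarrow> (F i y, F j x) \<in> E))" for F j
  have finA: "finite (pverts A)" by (simp add: A_def finite_pverts_A)
  \<comment> \<open>The number of neighbourhoods to delete when \<open>k\<close> copies are already
    present.\<close>
  have count: "m + k * card (pverts A) \<le> 4 * fact m" if "Suc k < m" for k
  proof -
    obtain l where l: "m = Suc (Suc l)" using m by (metis Suc_le_D numeral_2_eq_2 Suc_le_mono)
    have "m + k * card (pverts A) \<le> 4 * fact (m - 1) + l * (4 * fact (m - 1))"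
      using that l Suc_le_4_fact[of "m - 1"] card_A_le[of "m - 1"]
      unfolding A_def by (intro add_mono mult_le_mono) auto
    also have "\<dots> \<le> 4 * fact m" by (simp add: l algebra_simps)
    finally show ?thesis .
  qed
  have "\<exists>F. \<forall>j. 1 \<le> j \<and> j \<le> k \<longrightarrow> good F j" if "k < m" for k
    using that
  proof (induction k)
    case (Suc k)
    then obtain F where F: "\<And>j. 1 \<le> j \<Longrightarrow> j \<le> k \<Longrightarrow> good F j" by auto
    \<comment> \<open>\<open>v i\<close> must dominate copy \<open>Suc k\<close> when its index is
      at most \<open>Suc k\<close>, and be dominated by it otherwise; \<open>?N i\<close> is the
      opposite side.\<close>
    let ?N = "\<lambda>i. if i \<le> Suc k then E\<inverse> `` {v i} else E `` {v i}"
    let ?Q = "P (Suc k) - (\<Union>i\<in>{1..m}. ?N i)"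
    let ?f = "\<lambda>(i, x). F i x"
    let ?R = "?Q - (\<Union>w\<in>?f ` ({1..k} \<times> pverts A). E\<inverse> `` {w})"
    have PV: "P (Suc k) \<subseteq> V" using P Suc.prems by simp
    have "omega E (P (Suc k)) \<le> omega E ?Q + card {1..m} * s"
      using Suc.prems finite_sub[OF PV] vP_in[of _ "Suc k"] vP_out[of "Suc k"]
      by (intro omega_Diff_UN) (auto intro: less_imp_le)
    moreover have "omega E ?Q \<le> omega E ?R + card ({1..k} \<times> pverts A) * s"
    proof (rule omega_Diff_image)
      show "?Q \<subseteq> V" using PV by blast
      show "finite ({1..k} \<times> pverts A)" using finA by simp
      fix w assume "w \<in> ?f ` ({1..k} \<times> pverts A)"
      then obtain i x where ix: "1 \<le> i" "i \<le> k" "x \<in> pverts A" "w = F i x" by auto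
      then have "w \<in> P i" using F[of i] by (auto simp: good_def hom_into_def)
      then have "omega E (E\<inverse> `` {w} \<inter> P (Suc k)) < s"
        using PP_in ix Suc.prems by simp
      moreover have "omega E (E\<inverse> `` {w} \<inter> ?Q) \<le> omega E (E\<inverse> `` {w} \<inter> P (Suc k))"
        using finite_sub[OF PV] by (intro omega_mono) auto
      ultimately show "omega E (E\<inverse> `` {w} \<inter> ?Q) < s" by simp
    qed
    moreover have "(m + k * card (pverts A) + 1) * s \<le> (4 * fact m + 1) * s"
      using count[OF Suc.prems] by (intro mult_le_mono1) simp
    ultimately have "s \<le> omega E ?R"
      using P_large[of "Suc k"] Suc.prems by (simp add: card_cartesian_product algebra_simps)
    then obtain f where f: "hom_into E ?R A f"
      using large_A[of ?R] PV unfolding A_def by blast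
    define F' where "F' = F(Suc k := f)"
    have fR: "f x \<in> ?R" if "x \<in> pverts A" for x
      using f that by (auto simp: hom_into_def)
    have "good F' (Suc k)"
      unfolding good_def
    proof (intro conjI ballI allI impI)
      show "hom_into E (P (Suc k)) A (F' (Suc k))"
        using f by (auto simp: F'_def intro: hom_into_mono)
      fix x assume x: "x \<in> pverts A"
      have xV: "f x \<in> V" "f x \<in> P (Suc k)" using fR[OF x] PV by auto
      show "(v i, F' (Suc k) x) \<in> E" if i: "1 \<le> i \<and> i \<le> Suc k" for i
      proof -
        have "(f x, v i) \<notin> E" using fR[OF x] i Suc.prems by fastforce
        moreover have "v i \<in> V" "v i \<noteq> f x" using v[of i] vP[of i "Suc k"] xV i Suc.prems by auto
        ultimately show ?thesis using E_total xV by (auto simp: F'_def)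
      qed
      show "(F' (Suc k) x, v i) \<in> E" if i: "Suc k < i \<and> i \<le> m" for i
      proof -
        have "(v i, f x) \<notin> E" using fR[OF x] i Suc.prems by fastforce
        moreover have "v i \<in> V" "v i \<noteq> f x" using v[of i] vP[of i "Suc k"] xV i Suc.prems by auto
        ultimately show ?thesis using E_total xV by (auto simp: F'_def)
      qed
      show "(F' i y, F' (Suc k) x) \<in> E" if i: "1 \<le> i \<and> i < Suc k \<and> y \<in> pverts A" for i y
      proof -
        have nE: "(f x, F i y) \<notin> E" using fR[OF x] i by fastforce
        have FP: "F i y \<in> P i" using F[of i] i by (auto simp: good_def hom_into_def)
        have "P i \<subseteq> V" "P i \<inter> P (Suc k) = {}" using P[of i] PP[of i "Suc k"] i Suc.prems by auto
        with FP xV(2) have "F i y \<in> V" "f x \<noteq> F i y" by auto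
        with nE have "(F i y, f x) \<in> E" using E_total[OF xV(1)] by metis
        then show ?thesis using i by (simp add: F'_def)
      qed
    qed
    moreover have "good F' j" if "1 \<le> j" "j \<le> k" for j
      using F[OF that] that by (auto simp: good_def F'_def)
    ultimately have "good F' j" if "1 \<le> j \<and> j \<le> Suc k" for j
      using that by (cases "j = Suc k") auto
    then show ?case by blast
  qed simp
  from this[of "m - 1"] m obtain F where F: "\<And>j. 1 \<le> j \<Longrightarrow> j \<le> m - 1 \<Longrightarrow> good F j"
    by auto
  obtain l where l: "m = Suc (Suc l)" using m by (metis Suc_le_D numeral_2_eq_2 Suc_le_mono)
  have Am: "A_pair m = A_step m A" by (simp add: l A_def)
  define h where "h = case_vertex v F"
  have h: "h (Apex i) = v i" "h (Copy j x) = F j x" for i j x by (simp_all add: h_def)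
  have FP: "F j x \<in> V" if "1 \<le> j" "j \<le> m - 1" "x \<in> pverts A" for j x
  proof -
    have "P j \<subseteq> V" using that m by (intro P) auto
    then show ?thesis using F[of j] that by (auto simp: good_def hom_into_def)
  qed
  have "h a \<in> V" if "a \<in> pverts (A_pair m)" for a
    using that v FP unfolding Am by (cases a) (auto simp: A_step_simps h)
  moreover have "(h a, h b) \<in> E" if ab: "(a, b) \<in> parcs (A_pair m)" for a b
  proof (cases a; cases b)
    fix i j assume "a = Apex i" "b = Apex j"
    then show ?thesis using ab vv unfolding Am by (simp add: A_step_simps h)
  next
    fix i j x assume "a = Apex i" "b = Copy j x"
    then show ?thesis using ab F[of j] unfolding Am by (simp add: A_step_simps h good_def)
  next
    fix i j x assume eqs: "a = Copy j x" "b = Apex i"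
    then have "j \<le> m - 1" using ab unfolding Am by (auto simp: A_step_simps)
    then show ?thesis using eqs ab F[of j] unfolding Am by (simp add: A_step_simps h good_def)
  next
    fix i j x y assume "a = Copy i x" "b = Copy j y"
    then show ?thesis
      using ab F[of j] unfolding Am by (auto simp: A_step_simps h good_def hom_into_def)
  qed
  ultimately have "hom_into E V (A_pair m) h"
    by (auto simp: hom_into_def)
  then show ?thesis by blast
qed

end

section \<open>The bound for a tournament given by its arc relation\<close>

context D_free_tournament_rel
begin

text \<open>The factor 16 is 8 times 2: a clique has at most \<open>2 * M\<close> vertices in a
  block, and \<open>8 * m\<close> blocks are wanted in order to choose \<open>m\<close> of them at
  pairwise distance 8.\<close>

lemma omega_le_of_no_A:
  assumes m: "2 \<le> m"
    and no_A: "\<And>f. \<not> hom_into E V (A_pair m) f"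
    and large_A: "\<And>X. X \<subseteq> V \<Longrightarrow> s \<le> omega E X \<Longrightarrow> \<exists>f. hom_into E X (A_pair (m - 1)) f"
    and chains: "\<And>X. X \<subseteq> V \<Longrightarrow> K \<le> omega E X \<Longrightarrow>
      \<exists>Cs. length Cs = 8 \<and> chain Cs \<and> (\<forall>C\<in>set Cs. C \<subseteq> X)"
    and M: "K \<le> M" "(4 * fact m + 1) * s \<le> M"
  shows "omega E V \<le> 16 * m * M"
proof (rule ccontr)
  assume large: "\<not> ?thesis"
  obtain Bs where Bs: "chain Bs" and zones: "\<And>i. omega E {v \<in> V. zone Bs v = i} < K"
    using ex_chain_small_zones[OF chains] by blast
  have "omega E {v \<in> V. zone Bs v = i} \<le> M" for i
    using zones[of i] M(1) by simp
  then obtain \<beta> :: "'a \<Rightarrow> nat" where \<beta>: "\<And>x y. x \<in> V \<Longrightarrow> y \<in> V \<Longrightarrow> \<beta> x < \<beta> y \<Longrightarrow> zone Bs x < zone Bs y"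
    "\<And>b. omega E {x \<in> V. \<beta> x = b} \<le> 2 * M"
    "\<And>y b. y \<in> V \<Longrightarrow> b < \<beta> y \<Longrightarrow> M \<le> omega E {x \<in> V. \<beta> x = b}"
    by (rule ex_blocks[OF finite_V, of E "zone Bs" M]) blast
  have "0 < (4 * fact m + 1) * s" using s_pos by simp
  with M(2) have "0 < M" by linarith
  \<comment> \<open>Blocks before the block of \<open>y\<close> have clique number at least
    \<open>M\<close>, which is positive, so they are inhabited. Passing from \<open>x\<close> to
    \<open>y\<close> through two intermediate blocks increases the zone strictly three
    times.\<close>
  have gap: "zone Bs x + 3 \<le> zone Bs y" if xy: "x \<in> V" "y \<in> V" "\<beta> x + 4 \<le> \<beta> y" for x y
  proof -
    have "\<exists>z\<in>V. \<beta> z = b" if "b < \<beta> y" for b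
    proof (rule ccontr)
      assume "\<not> ?thesis"
      then have "{x \<in> V. \<beta> x = b} = {}" by blast
      with \<beta>(3)[OF xy(2) that] \<open>0 < M\<close> show False by (metis omega_empty not_less)
    qed
    from this[of "\<beta> x + 1"] this[of "\<beta> x + 2"] obtain z1 z2
      where z: "z1 \<in> V" "\<beta> z1 = \<beta> x + 1" "z2 \<in> V" "\<beta> z2 = \<beta> x + 2"
      using xy(3) by auto
    with \<beta>(1)[of x z1] \<beta>(1)[of z1 z2] \<beta>(1)[of z2 y] xy show ?thesis by linarith
  qed
  have "omega_le E {x \<in> V. \<beta> x = b} (2 * M)" for b
    using finite_V by (intro omega_le_mono[OF omega_le_omega order_refl \<beta>(2)]) auto
  then obtain r where r: "strict_linear_order_on V r" "\<And>u v. \<beta> u < \<beta> v \<Longrightarrow> (u, v) \<in> r"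
    "\<And>Q b. Q \<subseteq> V \<Longrightarrow> backedge_clique E r Q \<Longrightarrow> card {x \<in> Q. \<beta> x = b} \<le> 2 * M"
    by (rule ex_block_ordering[of E V \<beta> "\<lambda>_. 2 * M"]) blast
  have "\<not> omega_le E V (16 * m * M)" using large omega_leI by blast
  with r(1) obtain Q where Q: "Q \<subseteq> V" "backedge_clique E r Q" "16 * m * M < card Q"
    unfolding omega_le_def by (meson not_le)
  have many: "8 * m \<le> card (\<beta> ` Q)"
  proof (rule ccontr)
    assume few: "\<not> ?thesis"
    have finQ: "finite Q" using Q(1) finite_V by (rule finite_subset)
    have "Q = (\<Union>b\<in>\<beta> ` Q. {x \<in> Q. \<beta> x = b})" by blast
    then have "card Q \<le> (\<Sum>b\<in>\<beta> ` Q. card {x \<in> Q. \<beta> x = b})"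
      using card_UN_le[of "\<beta> ` Q" "\<lambda>b. {x \<in> Q. \<beta> x = b}"] finQ by simp
    also have "\<dots> \<le> card (\<beta> ` Q) * (2 * M)"
      using sum_bounded_above[of "\<beta> ` Q" "\<lambda>b. card {x \<in> Q. \<beta> x = b}" "2 * M"] r(3)[OF Q(1,2)] by simp
    also have "\<dots> \<le> 8 * m * (2 * M)" using few by (intro mult_le_mono1) simp
    finally show False using Q(3) by simp
  qed
  have "finite (\<beta> ` Q)" using finite_subset[OF Q(1) finite_V] by simp
  from ex_spaced_subset[OF zero_less_numeral this many]
  obtain g where g: "\<And>i. i \<in> {1..m} \<Longrightarrow> g i \<in> \<beta> ` Q"
    "\<And>i j. 1 \<le> i \<Longrightarrow> i < j \<Longrightarrow> j \<le> m \<Longrightarrow> g i + 8 \<le> g j"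
    by blast
  have "\<forall>i\<in>{1..m}. \<exists>x. x \<in> Q \<and> \<beta> x = g i"
    using g(1) by (metis imageE)
  from bchoice[OF this] obtain v where v: "\<And>i. i \<in> {1..m} \<Longrightarrow> v i \<in> Q \<and> \<beta> (v i) = g i"
    by blast
  \<comment> \<open>The chosen blocks are at least 8 apart, so this block is at least 4 away from
    every one of them, as \<open>gap\<close> demands.\<close>
  define P where "P j = {x \<in> V. \<beta> x = g j + 4}" for j
  have vV: "v i \<in> V" if "1 \<le> i" "i \<le> m" for i using v[of i] Q(1) that by auto
  have \<beta>v: "\<beta> (v i) = g i" if "1 \<le> i" "i \<le> m" for i using v[of i] that by simp
  have PV: "P j \<subseteq> V" for j by (auto simp: P_def)
  have "\<exists>f. hom_into E V (A_pair m) f"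
  proof (rule A_copy_from_backward_path[OF m large_A, where v = v and P = P])
    show "(v j, v i) \<in> E" if "1 \<le> i" "i < j" "j \<le> m" for i j
    proof -
      \<comment> \<open>The ordering puts \<open>v i\<close> first, so the clique property yields an
        arc directed backwards.\<close>
      have "\<beta> (v i) < \<beta> (v j)" using \<beta>v[of i] \<beta>v[of j] g(2)[OF that] that by simp
      then have "(v i, v j) \<in> r" by (rule r(2))
      then show ?thesis using Q(2) v[of i] v[of j] that by (auto simp: backedge_clique_def)
    qed
    show "v i \<notin> P j" if "1 \<le> i" "i \<le> m" "1 \<le> j" "j < m" for i j
      using that \<beta>v[of i] g(2)[of i j] g(2)[of j i]
      by (cases i j rule: linorder_cases) (auto simp: P_def)
    show "P i \<inter> P j = {}" if "1 \<le> i" "i < j" "j < m" for i j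
      using that g(2)[of i j] by (auto simp: P_def)
    show "omega E (E\<inverse> `` {v i} \<inter> P j) < s" if "1 \<le> i" "i \<le> j" "j < m" for i j
    proof -
      have "g i \<le> g j" using that g(2)[of i j] by (cases "i = j") auto
      then show ?thesis
        using that \<beta>v[of i] vV[of i]
        by (intro zone_separation(1)[OF Bs] gap PV) (auto simp: P_def)
    qed
    show "omega E (E `` {v i} \<inter> P j) < s" if "1 \<le> j" "j < i" "i \<le> m" for i j
      using that g(2)[of j i] \<beta>v[of i] vV[of i]
      by (intro zone_separation(2)[OF Bs] gap PV) (auto simp: P_def)
    show "omega E (E\<inverse> `` {x} \<inter> P j) < s" if "1 \<le> i" "i < j" "j < m" "x \<in> P i" for i j x
      using that g(2)[of i j]
      by (intro zone_separation(1)[OF Bs] gap PV) (auto simp: P_def)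
    show "(4 * fact m + 1) * s \<le> omega E (P j)" if "1 \<le> j" "j < m" for j
    proof -
      \<comment> \<open>This block comes before that of \<open>v (Suc j)\<close>, so it is one of
        those that have reached \<open>M\<close>.\<close>
      have "M \<le> omega E (P j)"
        unfolding P_def
        using that g(2)[of j "Suc j"] \<beta>v[of "Suc j"] by (intro \<beta>(3)[OF vV[of "Suc j"]]) auto
      with M(2) show ?thesis by simp
    qed
  qed (use vV PV in auto)
  then show False using no_A by blast
qed

end

section \<open>Digraphs and relations\<close>

lemma dominates_induce_iff:
  "u \<rightarrow>\<^bsub>G \<restriction> X\<^esub> v \<longleftrightarrow> u \<in> X \<and> v \<in> X \<and> u \<rightarrow>\<^bsub>G\<^esub> v"
  by (auto simp: arcs_ends_conv induce_subgraph_def)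

lemma clique_number_le_iff:
  assumes "finite (verts G)"
  shows "clique_number G \<le> k \<longleftrightarrow>
    (\<forall>Q\<subseteq>verts G. (\<forall>u\<in>Q. \<forall>v\<in>Q. u \<noteq> v \<longrightarrow> u \<rightarrow>\<^bsub>G\<^esub> v) \<longrightarrow> card Q \<le> k)"
proof -
  let ?S = "{Q. Q \<subseteq> verts G \<and> (\<forall>u \<in> Q. \<forall>v \<in> Q. u \<noteq> v \<longrightarrow> u \<rightarrow>\<^bsub>G\<^esub> v)}"
  have "?S \<subseteq> Pow (verts G)" by blast
  then have "finite ?S" by (rule finite_subset) (simp add: assms)
  moreover have "?S \<noteq> {}" by blast
  ultimately have "Max (card ` ?S) \<le> k \<longleftrightarrow> (\<forall>c\<in>card ` ?S. c \<le> k)"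
    by (intro Max_le_iff) auto
  also have "\<dots> \<longleftrightarrow> (\<forall>Q\<in>?S. card Q \<le> k)" by blast
  finally have "Max (card ` ?S) \<le> k \<longleftrightarrow> (\<forall>Q\<in>?S. card Q \<le> k)" .
  moreover have "clique_number G = Max (card ` ?S)"
    unfolding clique_number_def by (rule arg_cong[where f = Max]) blast
  ultimately show ?thesis by (simp add: imp_conjL)
qed

lemma clique_number_backedge_graph_le_iff:
  assumes "finite X" "X \<subseteq> verts T" "strict_linear_order_on X r"
  shows "clique_number (with_proj (backedge_graph (T \<restriction> X) r)) \<le> k \<longleftrightarrow>
    (\<forall>Q\<subseteq>X. backedge_clique (arcs_ends T) r Q \<longrightarrow> card Q \<le> k)"
proof -
  have r: "(u, v) \<notin> r" if "(v, u) \<in> r" for u v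
    using assms(3) that unfolding strict_linear_order_on_def trans_def irrefl_def by blast
  have "(\<forall>u\<in>Q. \<forall>v\<in>Q. u \<noteq> v \<longrightarrow> u \<rightarrow>\<^bsub>with_proj (backedge_graph (T \<restriction> X) r)\<^esub> v) \<longleftrightarrow>
      backedge_clique (arcs_ends T) r Q" (is "?L \<longleftrightarrow> ?R") if Q: "Q \<subseteq> X" for Q
  proof
    assume ?L
    show ?R
      unfolding backedge_clique_def
    proof (intro ballI impI)
      fix u v assume uv: "u \<in> Q" "v \<in> Q" "(u, v) \<in> r"
      then have "u \<noteq> v" using r by blast
      then have "(u, v) \<in> parcs (backedge_graph (T \<restriction> X) r)" using \<open>?L\<close> uv by auto
      then show "(v, u) \<in> arcs_ends T"
        using uv(3) r by (auto simp: backedge_graph_def dominates_induce_iff)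
    qed
  next
    assume ?R
    show ?L
    proof (intro ballI impI)
      fix u v assume uv: "u \<in> Q" "v \<in> Q" "u \<noteq> v"
      then have "(u, v) \<in> r \<or> (v, u) \<in> r"
        using assms(3) Q unfolding strict_linear_order_on_def total_on_def by blast
      then show "u \<rightarrow>\<^bsub>with_proj (backedge_graph (T \<restriction> X) r)\<^esub> v"
        using \<open>?R\<close> uv Q by (auto simp: backedge_clique_def backedge_graph_def dominates_induce_iff)
    qed
  qed
  then show ?thesis
    using assms(1) by (subst clique_number_le_iff) (auto simp: backedge_graph_def)
qed

text \<open>The clique numbers over all orderings are at most \<open>card X\<close>, so the minimum
  is attained, and both sides have the same upper bounds.\<close>

lemma tournament_clique_number_eq_omega:
  assumes "finite X" "X \<subseteq> verts T"
  shows "tournament_clique_number (T \<restriction> X) = omega (arcs_ends T) X"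
proof -
  let ?c = "\<lambda>r. clique_number (with_proj (backedge_graph (T \<restriction> X) r))"
  let ?S = "?c ` {r. strict_linear_order_on X r}"
  have le: "?c r \<le> k \<longleftrightarrow> (\<forall>Q\<subseteq>X. backedge_clique (arcs_ends T) r Q \<longrightarrow> card Q \<le> k)"
    if "strict_linear_order_on X r" for r k
    by (rule clique_number_backedge_graph_le_iff[OF assms that])
  have "?c r \<le> card X" if "strict_linear_order_on X r" for r
    using le[OF that, of "card X"] assms(1) by (auto intro: card_mono)
  then have "?S \<subseteq> {..card X}" by auto
  then have fin: "finite ?S" by (rule finite_subset) simp
  have ne: "?S \<noteq> {}" using ex_strict_linear_order_on[OF assms(1)] by auto
  have eq: "tournament_clique_number (T \<restriction> X) = Min ?S"
    unfolding tournament_clique_number_def by (rule arg_cong[where f = Min]) auto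
  have iff: "Min ?S \<le> k \<longleftrightarrow> omega_le (arcs_ends T) X k" for k
  proof -
    have "Min ?S \<le> k \<longleftrightarrow> (\<exists>r. strict_linear_order_on X r \<and> ?c r \<le> k)"
      using fin ne by (subst Min_le_iff) auto
    also have "\<dots> \<longleftrightarrow> omega_le (arcs_ends T) X k"
      unfolding omega_le_def using le by blast
    finally show ?thesis .
  qed
  show ?thesis
    unfolding eq
  proof (rule antisym)
    show "Min ?S \<le> omega (arcs_ends T) X"
      using iff omega_le_omega[OF assms(1)] by blast
    show "omega (arcs_ends T) X \<le> Min ?S"
      using iff by (intro omega_leI) blast
  qed
qed

text \<open>An induced subgraph is determined by its vertex set, so statements about subtournaments
  become statements about subsets.\<close>

lemma induced_subgraph_eq_induce:
  assumes "induced_subgraph S T"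
  shows "S = T \<restriction> verts S" "verts S \<subseteq> verts T"
  using assms unfolding induced_subgraph_def subgraph_def compatible_def induce_subgraph_def
  by (auto intro!: pre_digraph.equality)

section \<open>Copies as homomorphisms\<close>

lemma contains_copy_imp_hom:
  assumes "contains_copy S (with_proj H)"
  shows "\<exists>f. hom_into (arcs_ends S) (verts S) H f"
proof -
  obtain S' h where S': "induced_subgraph S' S" "pre_digraph.digraph_isomorphism S' h"
    and H: "with_proj H = app_iso h S'"
    using assms unfolding contains_copy_def digraph_iso_def by blast
  \<comment> \<open>The isomorphism maps the subgraph onto \<open>H\<close>; the embedding is its
    inverse.\<close>
  let ?f = "the_inv_into (verts S') (iso_verts h)"
  have inj: "inj_on (iso_verts h) (verts S')" and wf: "wf_digraph S'"
    using S'(2) by (auto simp: pre_digraph.digraph_isomorphism_def)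
  have verts: "pverts H = iso_verts h ` verts S'" and arcs: "parcs H = iso_arcs h ` arcs S'"
    and ends: "iso_tail h = fst" "iso_head h = snd"
    using H by (metis with_proj_simps app_iso_simps)+
  have "?f ` pverts H \<subseteq> verts S"
    using inj induced_subgraph_eq_induce(2)[OF S'(1)] by (auto simp: verts the_inv_into_f_f)
  moreover have "(?f a, ?f b) \<in> arcs_ends S" if ab: "(a, b) \<in> parcs H" for a b
  proof -
    obtain e where e: "e \<in> arcs S'" "iso_arcs h e = (a, b)" using ab arcs by auto
    then have "iso_verts h (tail S' e) = a" "iso_verts h (head S' e) = b"
      using S'(2) ends by (auto simp: pre_digraph.digraph_isomorphism_def)
    then have "?f a = tail S' e" "?f b = head S' e"
      using the_inv_into_f_f[OF inj] wf_digraph.tail_in_verts[OF wf e(1)]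
        wf_digraph.head_in_verts[OF wf e(1)] by auto
    then have "(?f a, ?f b) \<in> arcs_ends S'" using e(1) by (auto simp: arcs_ends_conv)
    then show ?thesis
      using arcs_ends_mono[of S' S] S'(1) by (auto simp: induced_subgraph_def)
  qed
  ultimately have "hom_into (arcs_ends S) (verts S) H ?f" by (auto simp: hom_into_def)
  then show ?thesis by blast
qed

lemma tournament_asym:
  assumes "tournament T" "(u, v) \<in> arcs_ends T"
  shows "u \<in> verts T" "v \<in> verts T" "(v, u) \<notin> arcs_ends T"
proof -
  interpret tournament T by fact
  obtain e where e: "e \<in> arcs T" "tail T e = u" "head T e = v"
    using assms(2) by (auto simp: arcs_ends_conv)
  then show uv: "u \<in> verts T" "v \<in> verts T" by auto
  have "u \<noteq> v" using no_loops e by auto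
  then show "(v, u) \<notin> arcs_ends T" using exactly_one_arc[OF uv] assms(2) by blast
qed

text \<open>Distinct vertices of \<open>H\<close> are joined by an arc, and arcs of \<open>T\<close>
  are asymmetric and loopless. Hence a homomorphism is injective and reflects arcs, and its inverse
  is an isomorphism from the subtournament on its image.\<close>

lemma hom_imp_contains_copy:
  assumes T: "tournament T" and H: "pair_tournament H"
    and X: "X \<subseteq> verts T" and f: "hom_into (arcs_ends T) X H f"
  shows "contains_copy (T \<restriction> X) (with_proj H)"
proof -
  interpret tournament T by fact
  let ?E = "arcs_ends T"
  note H = pair_tournamentD[OF H]
  have hom: "(f a, f b) \<in> ?E" if "(a, b) \<in> parcs H" for a b
    using f that by (auto simp: hom_into_def)
  have sub: "f ` pverts H \<subseteq> X" using f by (simp add: hom_into_def)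
  have inj: "inj_on f (pverts H)"
    by (rule inj_onI) (metis H(3) hom tournament_asym(3)[OF T])
  have iff: "(a, b) \<in> parcs H" if "a \<in> pverts H" "b \<in> pverts H" "(f a, f b) \<in> ?E" for a b
    using that H(3)[of a b] hom[of b a] tournament_asym(3)[OF T] by metis
  let ?Y = "f ` pverts H" and ?g = "the_inv_into (pverts H) f"
  have g: "?g (f a) = a" if "a \<in> pverts H" for a
    using that inj by (simp add: the_inv_into_f_f)
  define S where "S = T \<restriction> ?Y"
  have arcS: "arcs S = {e \<in> arcs T. tail T e \<in> ?Y \<and> head T e \<in> ?Y}"
    by (simp add: S_def induce_subgraph_def)
  have S: "verts S = ?Y" "tail S = tail T" "head S = head T"
    by (simp_all add: S_def)
  have wf: "wf_digraph S" unfolding S_def by (rule wellformed_induce_subgraph)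
  \<comment> \<open>Arcs go to the pairs of images of their ends; this is injective because
    \<open>T\<close> has no parallel arcs.\<close>
  let ?h = "\<lparr>iso_verts = ?g, iso_arcs = (\<lambda>e. (?g (tail T e), ?g (head T e))),
    iso_head = snd, iso_tail = fst\<rparr>"
  have gY: "f (?g y) = y" "?g y \<in> pverts H" if "y \<in> ?Y" for y
    using that g by auto
  have ind: "induced_subgraph S (T \<restriction> X)"
    unfolding induced_subgraph_def subgraph_def compatible_def
    using sub wf wellformed_induce_subgraph by (auto simp: arcS S induce_subgraph_def)
  have "inj_on (iso_arcs ?h) (arcs S)"
  proof (rule inj_onI)
    fix d e assume de: "d \<in> arcs S" "e \<in> arcs S" "iso_arcs ?h d = iso_arcs ?h e"
    then have "?g (tail T d) = ?g (tail T e)" "?g (head T d) = ?g (head T e)" by simp_all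
    then have "tail T d = tail T e" "head T d = head T e"
      using de(1,2) by (auto simp: arcS intro: inj_onD[OF inj_on_the_inv_into[OF inj]])
    then show "d = e"
      using de(1,2) by (intro no_multi_arcs) (auto simp: arcS arc_to_ends_def)
  qed
  then have iso: "pre_digraph.digraph_isomorphism S ?h"
    unfolding pre_digraph.digraph_isomorphism_def
    using wf by (auto simp: S inj inj_on_the_inv_into)
  have "iso_arcs ?h ` arcs S = parcs H"
  proof (intro equalityI subsetI)
    fix p assume "p \<in> iso_arcs ?h ` arcs S"
    then obtain e where e: "e \<in> arcs T" "tail T e \<in> ?Y" "head T e \<in> ?Y"
      "p = (?g (tail T e), ?g (head T e))"
      by (auto simp: arcS)
    moreover have "(tail T e, head T e) \<in> ?E" using e(1) by (auto simp: arcs_ends_conv)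
    ultimately show "p \<in> parcs H" using gY by (auto intro!: iff)
  next
    fix p assume p: "p \<in> parcs H"
    obtain a b where ab: "p = (a, b)" by (cases p)
    then have ab': "a \<in> pverts H" "b \<in> pverts H" using H(2)[of a b] p by auto
    obtain e where e: "e \<in> arcs T" "tail T e = f a" "head T e = f b"
      using hom[of a b] p ab by (auto simp: arcs_ends_conv)
    then have "e \<in> arcs S" using ab' by (auto simp: arcS)
    moreover have "p = iso_arcs ?h e" using e ab ab' g by simp
    ultimately show "p \<in> iso_arcs ?h ` arcs S" by blast
  qed
  moreover have "?g ` ?Y = pverts H" using g by (force simp: image_image)
  ultimately have "with_proj H = app_iso ?h S"
    by (simp add: with_proj_def app_iso_def S)
  with iso ind show ?thesis
    unfolding contains_copy_def digraph_iso_def by blast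
qed

lemma contains_copy_induce_iff:
  assumes "tournament T" "pair_tournament H" "X \<subseteq> verts T"
  shows "contains_copy (T \<restriction> X) (with_proj H) \<longleftrightarrow> (\<exists>f. hom_into (arcs_ends T) X H f)"
proof
  assume "contains_copy (T \<restriction> X) (with_proj H)"
  then obtain f where "hom_into (arcs_ends (T \<restriction> X)) (verts (T \<restriction> X)) H f"
    using contains_copy_imp_hom by blast
  then have "hom_into (arcs_ends T) X H f"
    by (auto simp: hom_into_def dominates_induce_iff)
  then show "\<exists>f. hom_into (arcs_ends T) X H f" by blast
qed (use hom_imp_contains_copy assms in blast)

section \<open>Relabelling by natural numbers\<close>

lemma induce_verts: "wf_digraph T \<Longrightarrow> T \<restriction> verts T = T"
  by (intro pre_digraph.equality) (auto simp: induce_subgraph_def wf_digraph_def)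

lemma tournament_with_proj:
  assumes "pair_tournament H"
  shows "tournament (with_proj H)"
proof -
  note H = pair_tournamentD[OF assms]
  interpret pair_digraph H
  proof
    show "finite (pverts H)" by (rule H(1))
    have "parcs H \<subseteq> pverts H \<times> pverts H" using H(2) by auto
    then show "finite (parcs H)" by (rule finite_subset) (simp add: H(1))
    fix e assume e: "e \<in> parcs H"
    then show "fst e \<in> pverts H" "snd e \<in> pverts H" "fst e \<noteq> snd e"
      using H(2)[of "fst e" "snd e"] by (cases e; auto)+
  qed
  show ?thesis
  proof
    fix u v assume "u \<in> verts (with_proj H)" "v \<in> verts (with_proj H)" "u \<noteq> v"
    then show "u \<rightarrow>\<^bsub>with_proj H\<^esub> v \<longleftrightarrow> \<not> v \<rightarrow>\<^bsub>with_proj H\<^esub> u"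
      using H(2)[of u v] H(3)[of u v] by auto
  qed
qed

text \<open>The property of \<open>C\<close> speaks about tournaments on natural numbers. The
  subtournament on \<open>X\<close> is relabelled along an injection \<open>g\<close>, the property
  is applied there, and the bags are pulled back.\<close>

lemma ex_bag_chain:
  assumes T: "tournament T" and C: "bag_chain_function n C" and X: "X \<subseteq> verts T"
    and large: "C c s \<le> omega (arcs_ends T) X"
    and no_D: "\<And>f. \<not> hom_into (arcs_ends T) X (D_pair n) f"
    and large_D: "\<And>Y. Y \<subseteq> X \<Longrightarrow> s \<le> omega (arcs_ends T) Y \<Longrightarrow>
      \<exists>f. hom_into (arcs_ends T) Y (D_pair (n - 1)) f"
  shows "\<exists>Bs. length Bs = 8 \<and> (\<forall>B\<in>set Bs. B \<subseteq> X \<and> omega (arcs_ends T) B = c) \<and>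
    sorted_wrt (\<lambda>A B. (\<forall>v\<in>B. omega (arcs_ends T) (arcs_ends T `` {v} \<inter> A) < s) \<and>
      (\<forall>w\<in>A. omega (arcs_ends T) ((arcs_ends T)\<inverse> `` {w} \<inter> B) < s)) Bs"
proof -
  interpret tournament T by fact
  let ?E = "arcs_ends T"
  have finX: "finite X" using X finite_verts by (rule finite_subset)
  obtain g :: "'a \<Rightarrow> nat" where g: "inj_on g X"
    using finite_imp_inj_to_nat_seg[OF finX] by blast
  define H where "H = \<lparr>pverts = g ` X, parcs = {(g u, g v) | u v. u \<in> X \<and> v \<in> X \<and> (u, v) \<in> ?E}\<rparr>"
  let ?T = "with_proj H" and ?F = "parcs H"
  have vH: "pverts H = g ` X" by (simp add: H_def)
  have F: "(g u, g v) \<in> ?F \<longleftrightarrow> (u, v) \<in> ?E" if "u \<in> X" "v \<in> X" for u v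
    using that g by (auto simp: H_def inj_on_eq_iff)
  have total: "(u, v) \<in> ?E \<or> (v, u) \<in> ?E" if "u \<in> X" "v \<in> X" "u \<noteq> v" for u v
    using exactly_one_arc[of u v] that X by blast
  have H: "pair_tournament H"
  proof (rule pair_tournamentI)
    show "finite (pverts H)" using finX by (simp add: vH)
    fix a b
    show "a \<in> pverts H \<and> b \<in> pverts H \<and> (b, a) \<notin> parcs H" if ab: "(a, b) \<in> parcs H"
    proof -
      obtain u v where "a = g u" "b = g v" "u \<in> X" "v \<in> X" "(u, v) \<in> ?E"
        using ab by (auto simp: H_def)
      then show ?thesis using F[of v u] tournament_asym[OF T] by (auto simp: vH)
    qed
    show "(a, b) \<in> parcs H \<or> (b, a) \<in> parcs H" if ab: "a \<in> pverts H" "b \<in> pverts H" "a \<noteq> b"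
    proof -
      obtain u v where "a = g u" "b = g v" "u \<in> X" "v \<in> X" using ab by (auto simp: vH)
      then show ?thesis using F[of v u] F[of u v] total[of u v] ab(3) by auto
    qed
  qed
  have T': "tournament ?T" using H by (rule tournament_with_proj)
  have om: "omega ?F (g ` Y) = omega ?E Y" if "Y \<subseteq> X" for Y
    using that F finX by (intro omega_image) (auto intro: inj_on_subset[OF g] finite_subset)
  have tcn: "tournament_clique_number (?T \<restriction> (g ` Y)) = omega ?E Y" if "Y \<subseteq> X" for Y
    using om[OF that] that finX
      tournament_clique_number_eq_omega[of "g ` Y" ?T] by (auto simp: vH finite_subset)
  \<comment> \<open>Copies in the relabelled tournament come from copies in \<open>X\<close>, so it
    is \<open>D_n\<close>-free too.\<close>
  have lift: "\<exists>f. hom_into ?E Y G f" if f: "hom_into ?F (g ` Y) G f" and Y: "Y \<subseteq> X"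
    and G: "pair_tournament G" for Y f and G :: "vertex pair_pre_digraph"
  proof -
    let ?i = "inv_into X g"
    have i: "?i (g y) = y" if "y \<in> X" for y using g that by simp
    have fY: "\<exists>y\<in>Y. f a = g y" if "a \<in> pverts G" for a using f that by (auto simp: hom_into_def)
    have "(?i (f a), ?i (f b)) \<in> ?E" if ab: "(a, b) \<in> parcs G" for a b
    proof -
      obtain y z where "y \<in> Y" "z \<in> Y" "f a = g y" "f b = g z"
        using fY pair_tournamentD(2)[OF G ab] by blast
      moreover have "(f a, f b) \<in> ?F" using f ab by (auto simp: hom_into_def)
      ultimately show ?thesis using F[of y z] Y i by (auto simp: subset_iff)
    qed
    moreover have "?i (f a) \<in> Y" if "a \<in> pverts G" for a
      using fY[OF that] Y i by auto
    ultimately have "hom_into ?E Y G (\<lambda>a. ?i (f a))" by (auto simp: hom_into_def)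
    then show ?thesis by blast
  qed
  have whole: "?T \<restriction> (g ` X) = ?T"
    using induce_verts[of ?T] T' by (simp add: vH tournament_def digraph_def fin_digraph_def)
  have "contains_copy S (D_tournament (n - 1))"
    if S: "induced_subgraph S ?T" "s \<le> tournament_clique_number S" for S
  proof -
    have vS: "S = ?T \<restriction> verts S" "verts S \<subseteq> g ` X"
      using induced_subgraph_eq_induce[OF S(1)] by (simp_all add: vH)
    then obtain Y where Y: "Y \<subseteq> X" "verts S = g ` Y" by (auto simp: subset_image_iff)
    have "s \<le> omega ?E Y" using S(2) vS(1) tcn[OF Y(1)] Y(2) by simp
    then obtain f where f: "hom_into ?E Y (D_pair (n - 1)) f" using large_D Y(1) by blast
    have "(g (f a), g (f b)) \<in> ?F" if ab: "(a, b) \<in> parcs (D_pair (n - 1))" for a b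
    proof -
      have "f a \<in> X" "f b \<in> X"
        using f Y(1) pair_tournamentD(2)[OF pair_tournament_D ab] by (auto simp: hom_into_def)
      moreover have "(f a, f b) \<in> ?E" using f ab by (auto simp: hom_into_def)
      ultimately show ?thesis using F by blast
    qed
    then have "hom_into ?F (g ` Y) (D_pair (n - 1)) (g \<circ> f)"
      using f by (auto simp: hom_into_def)
    then have "contains_copy (?T \<restriction> (g ` Y)) (D_tournament (n - 1))"
      using Y(1) by (intro hom_imp_contains_copy[OF T' pair_tournament_D]) (auto simp: vH)
    then show ?thesis using vS(1) Y(2) by simp
  qed
  moreover have "\<not> contains_copy ?T (D_tournament n)"
    using contains_copy_imp_hom[of ?T "D_pair n"] lift[OF _ order_refl pair_tournament_D] no_D
    by (auto simp: vH)
  moreover have "\<not> tournament_clique_number ?T < C c s"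
    using tcn[OF order_refl] whole large by simp
  \<comment> \<open>Two of the three alternatives have been excluded.\<close>
  ultimately obtain Bs where Bs: "bag_chain ?T c s 8 Bs"
    using C T' unfolding bag_chain_function_def by blast
  have len: "length Bs = 8" and sub: "\<And>i. i < 8 \<Longrightarrow> Bs ! i \<subseteq> g ` X"
    and bag: "\<And>i. i < 8 \<Longrightarrow> tournament_clique_number (?T \<restriction> (Bs ! i)) = c"
    and out_small: "\<And>i j v. i < j \<Longrightarrow> j < 8 \<Longrightarrow> v \<in> Bs ! j \<Longrightarrow>
      tournament_clique_number (?T \<restriction> (out_nbhd ?T v \<inter> Bs ! i)) < s"
    and in_small: "\<And>i j w. i < j \<Longrightarrow> j < 8 \<Longrightarrow> w \<in> Bs ! i \<Longrightarrow>
      tournament_clique_number (?T \<restriction> (in_nbhd ?T w \<inter> Bs ! j)) < s"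
    using Bs unfolding bag_chain_def by (simp_all add: vH)
  \<comment> \<open>Preimages are taken within \<open>X\<close>, where \<open>g\<close> is
    injective.\<close>
  let ?p = "\<lambda>B. {x \<in> X. g x \<in> B}"
  have gp: "g ` ?p B = B" if "B \<subseteq> g ` X" for B
    using that by blast
  have out: "out_nbhd ?T (g v) \<inter> B = g ` (?E `` {v} \<inter> ?p B)" if "B \<subseteq> g ` X" "v \<in> X" for B v
    using F[OF that(2)] that(1) by (auto simp: out_nbhd_def vH)
  have inn: "in_nbhd ?T (g v) \<inter> B = g ` (?E\<inverse> `` {v} \<inter> ?p B)" if "B \<subseteq> g ` X" "v \<in> X" for B v
    using F[OF _ that(2)] that(1) by (auto simp: in_nbhd_def vH)
  have "omega ?E (?p (Bs ! i)) = c" if "i < 8" for i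
    using bag[OF that] tcn[of "?p (Bs ! i)"] gp[OF sub[OF that]] by simp
  moreover have "omega ?E (?E `` {v} \<inter> ?p (Bs ! i)) < s"
    if "i < j" "j < 8" "v \<in> X" "g v \<in> Bs ! j" for i j v
  proof -
    have i: "i < 8" using that by simp
    have "?E `` {v} \<inter> ?p (Bs ! i) \<subseteq> X" by blast
    from tcn[OF this] show ?thesis
      using out_small[OF that(1,2,4)] unfolding out[OF sub[OF i] that(3)] by simp
  qed
  moreover have "omega ?E (?E\<inverse> `` {w} \<inter> ?p (Bs ! j)) < s"
    if "i < j" "j < 8" "w \<in> X" "g w \<in> Bs ! i" for i j w
  proof -
    have "?E\<inverse> `` {w} \<inter> ?p (Bs ! j) \<subseteq> X" by blast
    from tcn[OF this] show ?thesis
      using in_small[OF that(1,2,4)] unfolding inn[OF sub[OF that(2)] that(3)] by simp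
  qed
  ultimately show ?thesis
    using len by (intro exI[of _ "map ?p Bs"])
      (auto simp: sorted_wrt_iff_nth_less in_set_conv_nth)
qed

section \<open>Transfer of the bound to digraphs\<close>

theorem theorem6p1:
  fixes m n c_small c_large :: nat
    and C :: "nat \<Rightarrow> nat \<Rightarrow> nat"
    and T :: "('a, 'b) pre_digraph"
  assumes "2 \<le> m" and "2 \<le> n"
    and "2 ^ n * c_small \<le> c_large"
    and "bag_chain_function n C"
    and "tournament T"
    and "\<not> contains_copy T (A_tournament m)"
    and "\<not> contains_copy T (D_tournament n)"
    and "\<And>S. induced_subgraph S T \<Longrightarrow> c_small \<le> tournament_clique_number S \<Longrightarrow>
           contains_copy S (A_tournament (m - 1)) \<and> contains_copy S (D_tournament (n - 1))"
  shows "tournament_clique_number T \<le>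
    16 * m * Max {c_large, C c_large c_small, (4 * fact m + 1) * c_small}"
proof -
  interpret T: tournament T by fact
  let ?E = "arcs_ends T" and ?V = "verts T"
  have whole: "T \<restriction> ?V = T" using T.wf_digraph_axioms by (rule induce_verts)
  have copies: "(\<exists>f. hom_into ?E X (A_pair (m - 1)) f) \<and> (\<exists>f. hom_into ?E X (D_pair (n - 1)) f)"
    if X: "X \<subseteq> ?V" "c_small \<le> omega ?E X" for X
  proof -
    have "tournament_clique_number (T \<restriction> X) = omega ?E X"
      using X(1) T.finite_verts by (intro tournament_clique_number_eq_omega) (auto intro: finite_subset)
    then show ?thesis
      using assms(8)[OF T.induced_induce[OF X(1)]] X
        contains_copy_induce_iff[OF assms(5) pair_tournament_A X(1)]
        contains_copy_induce_iff[OF assms(5) pair_tournament_D X(1)] by simp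
  qed
  have no_A: "\<not> hom_into ?E ?V (A_pair m) f" for f
    using contains_copy_induce_iff[OF assms(5) pair_tournament_A order_refl, of m] assms(6) whole by auto
  have no_D: "\<not> hom_into ?E ?V (D_pair n) f" for f
    using contains_copy_induce_iff[OF assms(5) pair_tournament_D order_refl, of n] assms(7) whole by auto
  interpret R: D_free_tournament_rel ?V ?E c_small c_large n
  proof
    show "finite ?V" by (rule T.finite_verts)
    show "(u, v) \<in> ?E \<Longrightarrow> (v, u) \<notin> ?E" for u v by (rule tournament_asym(3)[OF assms(5)])
    show "(u, v) \<in> ?E \<or> (v, u) \<in> ?E" if "u \<in> ?V" "v \<in> ?V" "u \<noteq> v" for u v
      using T.exactly_one_arc[OF that] by blast
  qed (use assms(2,3) no_D copies in auto)
  have "\<exists>Cs. length Cs = 8 \<and> R.chain Cs \<and> (\<forall>B\<in>set Cs. B \<subseteq> X)"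
    if X: "X \<subseteq> ?V" "C c_large c_small \<le> omega ?E X" for X
  proof -
    \<comment> \<open>Freeness from \<open>D_n\<close> passes to \<open>X\<close>, so the property
      of \<open>C\<close> can only yield a bag-chain inside \<open>X\<close>.\<close>
    have "\<not> hom_into ?E X (D_pair n) f" for f using no_D hom_into_mono[OF _ X(1)] by blast
    then obtain Bs where "length Bs = 8" "\<And>B. B \<in> set Bs \<Longrightarrow> B \<subseteq> X \<and> omega ?E B = c_large"
      "sorted_wrt (\<lambda>A B. (\<forall>v\<in>B. omega ?E (?E `` {v} \<inter> A) < c_small) \<and>
        (\<forall>w\<in>A. omega ?E (?E\<inverse> `` {w} \<inter> B) < c_small)) Bs"
      using ex_bag_chain[OF assms(5,4) X] copies X(1) by (meson subset_trans)
    then have "R.chain Bs"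
      using X(1) unfolding R.chain_def R.precedes_def by blast
    with \<open>length Bs = 8\<close> \<open>\<And>B. B \<in> set Bs \<Longrightarrow> B \<subseteq> X \<and> omega ?E B = c_large\<close> show ?thesis by blast
  qed
  then have "omega ?E ?V \<le> 16 * m * Max {c_large, C c_large c_small, (4 * fact m + 1) * c_small}"
    using assms(1) no_A copies by (intro R.omega_le_of_no_A) auto
  moreover have "tournament_clique_number T = omega ?E ?V"
    using tournament_clique_number_eq_omega[OF T.finite_verts order_refl] whole by simp
  ultimately show ?thesis by simp
qed

end
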